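(* The group $\mathfrak{G}_2=r\mathrm{Spin}(2)+\mathbb{R}^2$ has the following two irreducible representations, which are equivalent to each other: (1) $\tilde{\tilde\pi}^-_{(r,s,b)}g(\underline{y})=e^{i2\pi\, b\cdot\underline{y}}\,r\,s\,g(r\,s^{-1}\underline{y}s)$ for $g\in\tilde{\tilde H}^-_1$, $(r,s,b)\in\mathfrak{G}_2$; (2) $\tilde{\tilde\pi}^+_{(r,s,b)}g(\underline{y})=e^{i2\pi\, b\cdot\underline{y}}\,r\,s\,g(r\,s^{-1}\underline{y}s)$ for $g\in\tilde{\tilde H}^+_1$, $(r,s,b)\in\mathfrak{G}_2$; where $$\tilde{\tilde H}^-_1=\Big\{s_{\underline{y}/|\underline{y}|}\,\alpha(\underline{y})\,(e_1+ie_2+1-ie_1e_2):\alpha\in L^2(\mathbb{R}^2)\Big\},$$ $$\tilde{\tilde H}^+_1=\Big\{s_{\underline{y}/|\underline{y}|}\,\alpha(\underline{y})\,(e_1+ie_2-(1-ie_1e_2)):\alpha\in L^2(\mathbb{R}^2)\Big\}.$$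
   Context: $\mathrm{Cl}_2$ is the Clifford algebra with generators $e_1,e_2$, $e_1^2=e_2^2=-1$, $e_1e_2=-e_2e_1$; function values lie in its complexification, with $i$ the complex unit commuting with $e_1,e_2$. A vector $x\in\mathbb{R}^2$ is identified with $\underline{x}=x_1e_1+x_2e_2$. $L^2(\mathbb{R}^2)$ is the space of complex-valued square-integrable functions. $\mathrm{Spin}(2)=\{\cos\theta+\sin\theta\,e_1e_2\}$ acts on $\mathbb{R}^2$ by $\underline{x}\mapsto s\underline{x}s^{-1}$. $\mathfrak{G}_2=r\mathrm{Spin}(2)+\mathbb{R}^2$ is the group of triples $(r,s,b)$, $r>0$, $s\in\mathrm{Spin}(2)$, $b\in\mathbb{R}^2$, with product $(r,s,b)(r',s',b')=(rr',ss',rsb's^{-1}+b)$. For $\omega\in S^1$, $s_\omega=\cos\phi+\sin\phi\,e_1e_2$ with $\phi\in[0,\pi)$ is the element such that $s_\omega e_2s_\omega^{-1}=\omega$. *)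

theory Defs
  imports "HOL-Analysis.Analysis" "HOL-Algebra.Group"
begin

section \<open>Complex inner product spaces\<close>

text \<open>The inner product is conjugate-linear in the first argument. Its real part is the
  \<^const>\<open>inner\<close> of the library, so that \<^const>\<open>norm\<close>, \<^const>\<open>closed\<close> and \<^const>\<open>complete\<close>
  have their usual Hilbert space meaning.\<close>

class complex_inner = real_inner +
  fixes scaleC :: "complex \<Rightarrow> 'a \<Rightarrow> 'a" (infixr "*\<^sub>C" 75)
    and cinner :: "'a \<Rightarrow> 'a \<Rightarrow> complex"
  assumes scaleC_add_right: "a *\<^sub>C (x + y) = a *\<^sub>C x + a *\<^sub>C y"
    and scaleC_add_left: "(a + b) *\<^sub>C x = a *\<^sub>C x + b *\<^sub>C x"
    and scaleC_scaleC: "a *\<^sub>C b *\<^sub>C x = (a * b) *\<^sub>C x"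
    and scaleR_scaleC: "r *\<^sub>R x = complex_of_real r *\<^sub>C x"
    and cinner_commute: "cinner x y = cnj (cinner y x)"
    and cinner_add_right: "cinner x (y + z) = cinner x y + cinner x z"
    and cinner_scaleC_right: "cinner x (a *\<^sub>C y) = a * cinner x y"
    and inner_eq_Re_cinner: "inner x y = Re (cinner x y)"

definition csubspace :: "'a::complex_inner set \<Rightarrow> bool" where
  "csubspace H \<longleftrightarrow> 0 \<in> H \<and> (\<forall>x\<in>H. \<forall>y\<in>H. x + y \<in> H) \<and> (\<forall>c. \<forall>x\<in>H. c *\<^sub>C x \<in> H)"

text \<open>Unitary maps between two complex subspaces (of possibly different ambient spaces);
  injectivity follows from preservation of the inner product.\<close>

definition unitary_map ::
  "'a::complex_inner set \<Rightarrow> 'b::complex_inner set \<Rightarrow> ('a \<Rightarrow> 'b) \<Rightarrow> bool" where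
  "unitary_map H K T \<longleftrightarrow> T ` H = K
     \<and> (\<forall>x\<in>H. \<forall>y\<in>H. T (x + y) = T x + T y)
     \<and> (\<forall>c. \<forall>x\<in>H. T (c *\<^sub>C x) = c *\<^sub>C T x)
     \<and> (\<forall>x\<in>H. \<forall>y\<in>H. cinner (T x) (T y) = cinner x y)"

section \<open>Unitary representations\<close>

text \<open>A unitary representation of \<open>G\<close> on the Hilbert space \<open>H\<close>, in the sense usual for
  topological groups: strong continuity is included. The topology on \<open>carrier G\<close> is the one
  induced from the type of its elements.\<close>

definition unitary_rep ::
  "('g::topological_space, 'm) monoid_scheme \<Rightarrow> 'a::complex_inner set \<Rightarrow> ('g \<Rightarrow> 'a \<Rightarrow> 'a) \<Rightarrow> bool"
  where
  "unitary_rep G H \<pi> \<longleftrightarrow> group G \<and> csubspace H \<and> complete H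
     \<and> (\<forall>g\<in>carrier G. unitary_map H H (\<pi> g))
     \<and> (\<forall>g\<in>carrier G. \<forall>h\<in>carrier G. \<forall>x\<in>H. \<pi> (g \<otimes>\<^bsub>G\<^esub> h) x = \<pi> g (\<pi> h x))
     \<and> (\<forall>x\<in>H. continuous_on (carrier G) (\<lambda>g. \<pi> g x))"

definition irreducible_unitary_rep ::
  "('g::topological_space, 'm) monoid_scheme \<Rightarrow> 'a::complex_inner set \<Rightarrow> ('g \<Rightarrow> 'a \<Rightarrow> 'a) \<Rightarrow> bool"
  where
  "irreducible_unitary_rep G H \<pi> \<longleftrightarrow> unitary_rep G H \<pi> \<and> H \<noteq> {0}
     \<and> (\<forall>V. V \<subseteq> H \<and> csubspace V \<and> closed V \<and> (\<forall>g\<in>carrier G. \<pi> g ` V \<subseteq> V)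
            \<longrightarrow> V = {0} \<or> V = H)"

definition equivalent_unitary_reps ::
  "('g, 'm) monoid_scheme \<Rightarrow> 'a::complex_inner set \<Rightarrow> ('g \<Rightarrow> 'a \<Rightarrow> 'a)
     \<Rightarrow> 'b::complex_inner set \<Rightarrow> ('g \<Rightarrow> 'b \<Rightarrow> 'b) \<Rightarrow> bool" where
  "equivalent_unitary_reps G H \<pi> K \<rho> \<longleftrightarrow>
     (\<exists>T. unitary_map H K T \<and> (\<forall>g\<in>carrier G. \<forall>x\<in>H. T (\<pi> g x) = \<rho> g (T x)))"

section \<open>The complexified Clifford algebra\<close>

text \<open>\<open>Cliff a b c d\<close> stands for \<open>a + b e\<^sub>1 + c e\<^sub>2 + d e\<^sub>1e\<^sub>2\<close>.\<close>

datatype cliff2 = Cliff (cf_0: complex) (cf_1: complex) (cf_2: complex) (cf_12: complex)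

instantiation cliff2 :: ring_1
begin
definition "0 = Cliff 0 0 0 0"
definition "1 = Cliff 1 0 0 0"
definition "x + y = Cliff (cf_0 x + cf_0 y) (cf_1 x + cf_1 y) (cf_2 x + cf_2 y) (cf_12 x + cf_12 y)"
definition "x - y = Cliff (cf_0 x - cf_0 y) (cf_1 x - cf_1 y) (cf_2 x - cf_2 y) (cf_12 x - cf_12 y)"
definition "- x = Cliff (- cf_0 x) (- cf_1 x) (- cf_2 x) (- cf_12 x)"
definition "x * y = Cliff
  (cf_0 x * cf_0 y - cf_1 x * cf_1 y - cf_2 x * cf_2 y - cf_12 x * cf_12 y)
  (cf_0 x * cf_1 y + cf_1 x * cf_0 y + cf_2 x * cf_12 y - cf_12 x * cf_2 y)
  (cf_0 x * cf_2 y + cf_2 x * cf_0 y - cf_1 x * cf_12 y + cf_12 x * cf_1 y)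
  (cf_0 x * cf_12 y + cf_12 x * cf_0 y + cf_1 x * cf_2 y - cf_2 x * cf_1 y)"
instance
  by standard (auto simp: zero_cliff2_def one_cliff2_def plus_cliff2_def minus_cliff2_def
    uminus_cliff2_def times_cliff2_def algebra_simps)
end

instantiation cliff2 :: complex_inner
begin
definition "scaleC c x = Cliff (c * cf_0 x) (c * cf_1 x) (c * cf_2 x) (c * cf_12 x)"
definition scaleR_cliff2 :: "real \<Rightarrow> cliff2 \<Rightarrow> cliff2" where
  "scaleR_cliff2 r x = complex_of_real r *\<^sub>C x"
definition "cinner x y = cnj (cf_0 x) * cf_0 y + cnj (cf_1 x) * cf_1 y
                       + cnj (cf_2 x) * cf_2 y + cnj (cf_12 x) * cf_12 y"
definition "inner x y = Re (cinner x (y :: cliff2))"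
definition norm_cliff2 :: "cliff2 \<Rightarrow> real" where "norm_cliff2 x = sqrt (inner x x)"
definition dist_cliff2 :: "cliff2 \<Rightarrow> cliff2 \<Rightarrow> real" where "dist_cliff2 x y = norm (x - y)"
definition sgn_cliff2 :: "cliff2 \<Rightarrow> cliff2" where "sgn_cliff2 x = inverse (norm x) *\<^sub>R x"
definition uniformity_cliff2 :: "(cliff2 \<times> cliff2) filter" where
  "uniformity_cliff2 = (INF e\<in>{0<..}. principal {(x, y). dist x y < e})"
definition open_cliff2 :: "cliff2 set \<Rightarrow> bool" where
  "open_cliff2 U \<longleftrightarrow> (\<forall>x\<in>U. \<forall>\<^sub>F (x', y) in uniformity. x' = x \<longrightarrow> y \<in> U)"
instance
proof
  fix x :: cliff2
  have *: "inner x x = (Re (cf_0 x))\<^sup>2 + (Im (cf_0 x))\<^sup>2 + (Re (cf_1 x))\<^sup>2 + (Im (cf_1 x))\<^sup>2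
      + (Re (cf_2 x))\<^sup>2 + (Im (cf_2 x))\<^sup>2 + (Re (cf_12 x))\<^sup>2 + (Im (cf_12 x))\<^sup>2"
    by (simp add: inner_cliff2_def cinner_cliff2_def power2_eq_square)
  show "0 \<le> inner x x" unfolding * by simp
  show "inner x x = 0 \<longleftrightarrow> x = 0"
    unfolding * by (cases x) (auto simp: zero_cliff2_def complex_eq_iff add_nonneg_eq_0_iff)
qed (auto simp: scaleC_cliff2_def scaleR_cliff2_def cinner_cliff2_def inner_cliff2_def
    norm_cliff2_def dist_cliff2_def sgn_cliff2_def uniformity_cliff2_def open_cliff2_def
    plus_cliff2_def algebra_simps)
end

instantiation cliff2 :: euclidean_space
begin
definition "Basis = {Cliff 1 0 0 0, Cliff 0 1 0 0, Cliff 0 0 1 0, Cliff 0 0 0 1,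
                     Cliff \<i> 0 0 0, Cliff 0 \<i> 0 0, Cliff 0 0 \<i> 0, Cliff 0 0 0 \<i>}"
instance
proof
  fix x :: cliff2
  show "(\<forall>u\<in>Basis. inner x u = 0) \<longleftrightarrow> x = 0"
    by (cases x) (auto simp: Basis_cliff2_def inner_cliff2_def cinner_cliff2_def
        zero_cliff2_def complex_eq_iff)
qed (auto simp: Basis_cliff2_def inner_cliff2_def cinner_cliff2_def)
end


section \<open>The spaces \<open>L\<^sup>2\<close>\<close>

lemma scaleC_zero_right [simp]: "c *\<^sub>C (0 :: 'a::complex_inner) = 0"
  using scaleC_add_right[of c 0 "0 :: 'a"] by simp

lemma scaleC_minus_right [simp]: "c *\<^sub>C (- x :: 'a::complex_inner) = - (c *\<^sub>C x)"
  using scaleC_add_right[of c x "- x"] by (metis add.right_inverse minus_unique scaleC_zero_right)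

lemma scaleC_diff_right: "c *\<^sub>C (x - y :: 'a::complex_inner) = c *\<^sub>C x - c *\<^sub>C y"
  using scaleC_add_right[of c x "- y"] by simp

lemma cinner_scaleC_left: "cinner (c *\<^sub>C x) (y :: 'a::complex_inner) = cnj c * cinner x y"
  by (subst cinner_commute, subst cinner_scaleC_right, subst cinner_commute[of y x]) simp

lemma cinner_self: "cinner x (x :: 'a::complex_inner) = complex_of_real ((norm x)\<^sup>2)"
proof -
  have "Im (cinner x x) = 0"
    using arg_cong[OF cinner_commute[of x x], of Im] by simp
  moreover have "Re (cinner x x) = (norm x)\<^sup>2"
    using inner_eq_Re_cinner[of x x] by (simp add: power2_norm_eq_inner)
  ultimately show ?thesis by (simp add: complex_eq_iff)
qed

lemma norm_scaleC [simp]: "norm (c *\<^sub>C (x :: 'a::complex_inner)) = cmod c * norm x"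
proof -
  have "cinner (c *\<^sub>C x) (c *\<^sub>C x) = (c * cnj c) * cinner x x"
    by (simp only: cinner_scaleC_left cinner_scaleC_right mult_ac)
  also have "\<dots> = complex_of_real ((cmod c)\<^sup>2) * complex_of_real ((norm x)\<^sup>2)"
    by (simp only: complex_norm_square cinner_self)
  finally have "complex_of_real ((norm (c *\<^sub>C x))\<^sup>2) = complex_of_real ((cmod c * norm x)\<^sup>2)"
    by (simp only: cinner_self power_mult_distrib of_real_mult)
  hence "(norm (c *\<^sub>C x))\<^sup>2 = (cmod c * norm x)\<^sup>2"
    by (simp only: of_real_eq_iff)
  thus ?thesis by (simp add: power2_eq_iff_nonneg)
qed

lemma bounded_linear_scaleC: "bounded_linear (\<lambda>x :: 'a::complex_inner. c *\<^sub>C x)"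
proof (rule bounded_linear_intro[where K = "cmod c"])
  fix r and x :: 'a
  show "c *\<^sub>C r *\<^sub>R x = r *\<^sub>R c *\<^sub>C x"
    by (simp add: scaleR_scaleC scaleC_scaleC mult.commute)
qed (simp_all add: scaleC_add_right mult.commute)

lemma cinner_eq: "cinner x (y :: 'a::complex_inner) = Complex (inner x y) (inner (\<i> *\<^sub>C x) y)"
  by (simp add: complex_eq_iff inner_eq_Re_cinner cinner_scaleC_left)

lemma norm_cinner_le: "norm (cinner x (y :: 'a::complex_inner)) \<le> (norm x)\<^sup>2 + (norm y)\<^sup>2"
proof -
  have "norm (cinner x y) \<le> \<bar>inner x y\<bar> + \<bar>inner (\<i> *\<^sub>C x) y\<bar>"
    unfolding cinner_eq by (metis cmod_le complex.sel)
  also have "\<dots> \<le> norm x * norm y + norm x * norm y"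
    using Cauchy_Schwarz_ineq2[of x y] Cauchy_Schwarz_ineq2[of "\<i> *\<^sub>C x" y] by simp
  also have "\<dots> \<le> (norm x)\<^sup>2 + (norm y)\<^sup>2"
    using sum_squares_bound[of "norm x" "norm y"] by simp
  finally show ?thesis .
qed

lemma borel_measurable_scaleC [measurable]:
  fixes f :: "'a \<Rightarrow> 'b::{complex_inner, second_countable_topology}"
  assumes [measurable]: "f \<in> borel_measurable M"
  shows "(\<lambda>x. c *\<^sub>C f x) \<in> borel_measurable M"
  using bounded_linear.continuous_on[OF bounded_linear_scaleC continuous_on_id] assms
  by (rule borel_measurable_continuous_on)

lemma borel_measurable_cinner [measurable]:
  fixes f g :: "'a \<Rightarrow> 'b::{complex_inner, second_countable_topology}"
  assumes [measurable]: "f \<in> borel_measurable M" "g \<in> borel_measurable M"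
  shows "(\<lambda>x. cinner (f x) (g x)) \<in> borel_measurable M"
  unfolding cinner_eq Complex_eq by measurable

text \<open>Square-integrable functions, and the quotient by almost everywhere equality.\<close>

definition L2_fun :: "('a::euclidean_space \<Rightarrow> 'b::real_normed_vector) set" where
  "L2_fun = {f \<in> borel_measurable lborel. integrable lborel (\<lambda>x. (norm (f x))\<^sup>2)}"

definition L2_eq :: "('a::euclidean_space \<Rightarrow> 'b::real_normed_vector) \<Rightarrow> ('a \<Rightarrow> 'b) \<Rightarrow> bool" where
  "L2_eq f g \<longleftrightarrow> f \<in> L2_fun \<and> g \<in> L2_fun \<and> (AE x in lborel. f x = g x)"

lemma L2_fun_zero: "(\<lambda>_. 0) \<in> L2_fun"
  by (simp add: L2_fun_def)

lemma L2_fun_add: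
  fixes f g :: "'a::euclidean_space \<Rightarrow> 'b::{real_inner, second_countable_topology}"
  assumes "f \<in> L2_fun" "g \<in> L2_fun"
  shows "(\<lambda>x. f x + g x) \<in> L2_fun"
proof -
  from assms have [measurable]: "f \<in> borel_measurable lborel" "g \<in> borel_measurable lborel"
    and I: "integrable lborel (\<lambda>x. (norm (f x))\<^sup>2)" "integrable lborel (\<lambda>x. (norm (g x))\<^sup>2)"
    by (auto simp: L2_fun_def)
  have "integrable lborel (\<lambda>x. (norm (f x + g x))\<^sup>2)"
  proof (rule Bochner_Integration.integrable_bound)
    show "integrable lborel (\<lambda>x. 2 * (norm (f x))\<^sup>2 + 2 * (norm (g x))\<^sup>2)"
      using I by (intro Bochner_Integration.integrable_add integrable_mult_right)
    have "(norm (f x + g x))\<^sup>2 + (norm (f x - g x))\<^sup>2 = 2 * (norm (f x))\<^sup>2 + 2 * (norm (g x))\<^sup>2" for x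
      by (simp add: power2_norm_eq_inner inner_simps)
    hence "(norm (f x + g x))\<^sup>2 \<le> 2 * (norm (f x))\<^sup>2 + 2 * (norm (g x))\<^sup>2" for x
      by (metis le_add_same_cancel1 zero_le_power2)
    hence "norm ((norm (f x + g x))\<^sup>2) \<le> norm (2 * (norm (f x))\<^sup>2 + 2 * (norm (g x))\<^sup>2)" for x
      by simp
    thus "AE x in lborel. norm ((norm (f x + g x))\<^sup>2) \<le> norm (2 * (norm (f x))\<^sup>2 + 2 * (norm (g x))\<^sup>2)"
      by simp
  qed measurable
  thus ?thesis by (simp add: L2_fun_def)
qed

lemma L2_fun_scaleC:
  fixes f :: "'a::euclidean_space \<Rightarrow> 'b::{complex_inner, second_countable_topology}"
  shows "f \<in> L2_fun \<Longrightarrow> (\<lambda>x. c *\<^sub>C f x) \<in> L2_fun"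
  by (auto simp: L2_fun_def power_mult_distrib)

lemma L2_fun_uminus:
  fixes f :: "'a::euclidean_space \<Rightarrow> 'b::{complex_inner, second_countable_topology}"
  shows "f \<in> L2_fun \<Longrightarrow> (\<lambda>x. - f x) \<in> L2_fun"
  by (auto simp: L2_fun_def)

lemma L2_fun_diff:
  fixes f g :: "'a::euclidean_space \<Rightarrow> 'b::{complex_inner, second_countable_topology}"
  shows "f \<in> L2_fun \<Longrightarrow> g \<in> L2_fun \<Longrightarrow> (\<lambda>x. f x - g x) \<in> L2_fun"
  using L2_fun_add[OF _ L2_fun_uminus, of f g] by simp

lemma integrable_cinner:
  fixes f g :: "'a::euclidean_space \<Rightarrow> 'b::{complex_inner, second_countable_topology}"
  assumes "f \<in> L2_fun" "g \<in> L2_fun"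
  shows "integrable lborel (\<lambda>x. cinner (f x) (g x))"
proof -
  from assms have [measurable]: "f \<in> borel_measurable lborel" "g \<in> borel_measurable lborel"
    and I: "integrable lborel (\<lambda>x. (norm (f x))\<^sup>2)" "integrable lborel (\<lambda>x. (norm (g x))\<^sup>2)"
    by (auto simp: L2_fun_def)
  show ?thesis
  proof (rule Bochner_Integration.integrable_bound[OF Bochner_Integration.integrable_add[OF I]])
    have "norm (cinner (f x) (g x)) \<le> norm ((norm (f x))\<^sup>2 + (norm (g x))\<^sup>2)" for x
      using norm_cinner_le[of "f x" "g x"] by simp
    thus "AE x in lborel. norm (cinner (f x) (g x)) \<le> norm ((norm (f x))\<^sup>2 + (norm (g x))\<^sup>2)"
      by simp
  qed measurable
qed

quotient_type (overloaded) ('a, 'b) L2 =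
  "'a::euclidean_space \<Rightarrow> 'b::{complex_inner, second_countable_topology}" / partial: L2_eq
proof (rule part_equivpI)
  show "\<exists>f. L2_eq f f" by (rule exI[of _ "\<lambda>_. 0"]) (simp add: L2_eq_def L2_fun_zero)
  show "symp L2_eq" by (auto intro!: sympI simp: L2_eq_def)
  show "transp L2_eq" by (auto intro!: transpI simp: L2_eq_def)
qed

instantiation L2 :: (euclidean_space, "{complex_inner, second_countable_topology}") complex_inner
begin

lift_definition zero_L2 :: "('a, 'b) L2" is "\<lambda>_. 0"
  by (simp add: L2_eq_def L2_fun_zero)
lift_definition plus_L2 :: "('a, 'b) L2 \<Rightarrow> ('a, 'b) L2 \<Rightarrow> ('a, 'b) L2" is "\<lambda>f g x. f x + g x"
  unfolding L2_eq_def by (auto intro: L2_fun_add)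
lift_definition uminus_L2 :: "('a, 'b) L2 \<Rightarrow> ('a, 'b) L2" is "\<lambda>f x. - f x"
  unfolding L2_eq_def by (auto intro: L2_fun_uminus)
lift_definition minus_L2 :: "('a, 'b) L2 \<Rightarrow> ('a, 'b) L2 \<Rightarrow> ('a, 'b) L2" is "\<lambda>f g x. f x - g x"
  unfolding L2_eq_def by (auto intro: L2_fun_diff)
lift_definition scaleC_L2 :: "complex \<Rightarrow> ('a, 'b) L2 \<Rightarrow> ('a, 'b) L2" is "\<lambda>c f x. c *\<^sub>C f x"
  unfolding L2_eq_def by (auto intro: L2_fun_scaleC)
lift_definition cinner_L2 :: "('a, 'b) L2 \<Rightarrow> ('a, 'b) L2 \<Rightarrow> complex"
  is "\<lambda>f g. LINT x|lborel. cinner (f x) (g x)"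
  unfolding L2_eq_def
  by (intro integral_cong_AE) (auto simp: L2_fun_def intro!: borel_measurable_cinner)

definition scaleR_L2 :: "real \<Rightarrow> ('a, 'b) L2 \<Rightarrow> ('a, 'b) L2" where
  "scaleR_L2 r F = complex_of_real r *\<^sub>C F"
definition inner_L2 :: "('a, 'b) L2 \<Rightarrow> ('a, 'b) L2 \<Rightarrow> real" where
  "inner_L2 F G = Re (cinner F G)"
definition norm_L2 :: "('a, 'b) L2 \<Rightarrow> real" where "norm_L2 F = sqrt (inner F F)"
definition dist_L2 :: "('a, 'b) L2 \<Rightarrow> ('a, 'b) L2 \<Rightarrow> real" where "dist_L2 F G = norm (F - G)"
definition sgn_L2 :: "('a, 'b) L2 \<Rightarrow> ('a, 'b) L2" where "sgn_L2 F = inverse (norm F) *\<^sub>R F"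
definition uniformity_L2 :: "(('a, 'b) L2 \<times> ('a, 'b) L2) filter" where
  "uniformity_L2 = (INF e\<in>{0<..}. principal {(F, G). dist F G < e})"
definition open_L2 :: "('a, 'b) L2 set \<Rightarrow> bool" where
  "open_L2 U \<longleftrightarrow> (\<forall>F\<in>U. \<forall>\<^sub>F (F', G) in uniformity. F' = F \<longrightarrow> G \<in> U)"

instance
proof
  fix F G K :: "('a, 'b) L2" and a b :: complex and r r' :: real
  show 1: "F + G + K = F + (G + K)"
    by transfer (auto simp: L2_eq_def add.assoc intro!: L2_fun_add)
  show 2: "F + G = G + F"
    by transfer (auto simp: L2_eq_def add.commute intro!: L2_fun_add)
  show 3: "0 + F = F"
    by transfer (auto simp: L2_eq_def)
  show 4: "- F + F = 0"
    by transfer (auto simp: L2_eq_def L2_fun_zero)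
  show 5: "F - G = F + - G"
    by transfer (auto simp: L2_eq_def intro: L2_fun_diff)
  show C1: "a *\<^sub>C (F + G) = a *\<^sub>C F + a *\<^sub>C G"
    by transfer (auto simp: L2_eq_def scaleC_add_right intro!: L2_fun_add L2_fun_scaleC)
  show C2: "(a + b) *\<^sub>C F = a *\<^sub>C F + b *\<^sub>C F" for a b
    by transfer (auto simp: L2_eq_def scaleC_add_left intro!: L2_fun_add L2_fun_scaleC)
  show C3: "a *\<^sub>C b *\<^sub>C F = (a * b) *\<^sub>C F" for a b
    by transfer (auto simp: L2_eq_def scaleC_scaleC intro!: L2_fun_scaleC)
  have C4: "1 *\<^sub>C F = F"
    by transfer (auto simp: L2_eq_def simp flip: scaleR_scaleC[of 1, simplified])
  show C5: "r *\<^sub>R F = complex_of_real r *\<^sub>C F" for r and F :: "('a, 'b) L2"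
    by (simp add: scaleR_L2_def)
  show "r *\<^sub>R (F + G) = r *\<^sub>R F + r *\<^sub>R G"
    by (simp add: C5) (transfer, auto simp: L2_eq_def scaleC_add_right intro!: L2_fun_add L2_fun_scaleC)
  show "(r + r') *\<^sub>R F = r *\<^sub>R F + r' *\<^sub>R F"
    by (simp add: C5 C2)
  show "r *\<^sub>R r' *\<^sub>R F = (r * r') *\<^sub>R F"
    by (simp add: C5 C3)
  show "1 *\<^sub>R F = F"
    by (simp add: C5 C4)
  show I1: "cinner F G = cnj (cinner G F)" for F G :: "('a, 'b) L2"
    by transfer (simp flip: integral_cnj, subst cinner_commute, simp)
  show I2: "cinner F (G + K) = cinner F G + cinner F K" for F G K :: "('a, 'b) L2"
    by transfer (simp add: L2_eq_def cinner_add_right integrable_cinner)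
  show I3: "cinner F (a *\<^sub>C G) = a * cinner F G" for a and F G :: "('a, 'b) L2"
    by transfer (simp add: cinner_scaleC_right)
  show I4: "inner F G = Re (cinner F G)" for F G :: "('a, 'b) L2"
    by (simp add: inner_L2_def)
  show "inner F G = inner G F"
    unfolding I4 by (subst I1) simp
  show "inner (F + G) K = inner F K + inner G K"
    unfolding I4 by (subst (1 2 3) I1) (simp add: I2)
  show "inner (r *\<^sub>R F) G = r * inner F G"
    unfolding I4 C5 by (subst (1 2) I1) (simp add: I3)
  have sq: "inner F F \<ge> 0 \<and> (inner F F = 0 \<longleftrightarrow> F = 0)"
    unfolding I4
  proof transfer
    fix f :: "'a \<Rightarrow> 'b" assume "L2_eq f f"
    hence f: "f \<in> L2_fun" by (simp add: L2_eq_def)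
    have "(LINT x|lborel. cinner (f x) (f x)) = complex_of_real (LINT x|lborel. (norm (f x))\<^sup>2)"
      unfolding cinner_self by (rule integral_complex_of_real)
    moreover have "(LINT x|lborel. (norm (f x))\<^sup>2) = 0 \<longleftrightarrow> L2_eq f (\<lambda>_. 0)"
      using f by (subst integral_nonneg_eq_0_iff_AE) (auto simp: L2_eq_def L2_fun_def)
    ultimately show "0 \<le> Re (LINT x|lborel. cinner (f x) (f x)) \<and>
        (Re (LINT x|lborel. cinner (f x) (f x)) = 0 \<longleftrightarrow> L2_eq f (\<lambda>_. 0))"
      by simp
  qed
  show "0 \<le> inner F F" using sq by simp
  show "inner F F = 0 \<longleftrightarrow> F = 0" using sq by simp
qed (simp_all add: norm_L2_def dist_L2_def sgn_L2_def uniformity_L2_def open_L2_def)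

end

section \<open>Vectors and the group \<open>Spin(2)\<close>\<close>

definition e1 :: cliff2 ("e\<^sub>1") where "e\<^sub>1 = Cliff 0 1 0 0"
definition e2 :: cliff2 ("e\<^sub>2") where "e\<^sub>2 = Cliff 0 0 1 0"

lemma clifford_relations:
  "e\<^sub>1 * e\<^sub>1 = - 1" "e\<^sub>2 * e\<^sub>2 = - 1" "e\<^sub>1 * e\<^sub>2 = - (e\<^sub>2 * e\<^sub>1)"
  by (simp_all add: e1_def e2_def times_cliff2_def uminus_cliff2_def one_cliff2_def)

lemma Cliff_eq:
  "Cliff a b c d = a *\<^sub>C 1 + b *\<^sub>C e\<^sub>1 + c *\<^sub>C e\<^sub>2 + d *\<^sub>C (e\<^sub>1 * e\<^sub>2)"
  by (simp add: e1_def e2_def times_cliff2_def plus_cliff2_def one_cliff2_def scaleC_cliff2_def)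

lemma scaleC_mult_cliff2: "c *\<^sub>C x * y = c *\<^sub>C (x * y)" "x * c *\<^sub>C y = c *\<^sub>C (x * y)"
  for x y :: cliff2
  by (simp_all add: times_cliff2_def scaleC_cliff2_def algebra_simps)

definition cliff_inv :: "cliff2 \<Rightarrow> cliff2" where
  "cliff_inv x = (THE y. x * y = 1 \<and> y * x = 1)"

definition cliff_vec :: "real^2 \<Rightarrow> cliff2" where
  "cliff_vec x = (x $ 1) *\<^sub>R e\<^sub>1 + (x $ 2) *\<^sub>R e\<^sub>2"

text \<open>A left inverse of \<^const>\<open>cliff_vec\<close>; it is only applied to elements of the range of \<^const>\<open>cliff_vec\<close>,
  see \<open>cliff_vec_unvec_conj\<close> below.\<close>

definition cliff_unvec :: "cliff2 \<Rightarrow> real^2" where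
  "cliff_unvec q = vector [Re (cf_1 q), Re (cf_2 q)]"

definition spin :: "real \<Rightarrow> cliff2" where
  "spin \<theta> = cos \<theta> *\<^sub>R 1 + sin \<theta> *\<^sub>R (e\<^sub>1 * e\<^sub>2)"

definition Spin2 :: "cliff2 set" where
  "Spin2 = range spin"

lemma spin_eq: "spin \<theta> = Cliff (cos \<theta>) 0 0 (sin \<theta>)"
  by (simp add: spin_def e1_def e2_def one_cliff2_def times_cliff2_def plus_cliff2_def
      scaleR_cliff2_def scaleC_cliff2_def)

lemma cliff_vec_eq: "cliff_vec x = Cliff 0 (x $ 1) (x $ 2) 0"
  by (simp add: cliff_vec_def e1_def e2_def plus_cliff2_def scaleR_cliff2_def scaleC_cliff2_def)

lemma cliff_unvec_vec [simp]: "cliff_unvec (cliff_vec x) = x"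
  by (simp add: cliff_unvec_def cliff_vec_eq vec_eq_iff forall_2)

lemma spin_mult: "spin a * spin b = spin (a + b)"
  by (simp add: spin_eq times_cliff2_def cos_add sin_add)

lemma spin_0 [simp]: "spin 0 = 1"
  by (simp add: spin_eq one_cliff2_def)

lemma cliff_inv_unique: "x * y = 1 \<Longrightarrow> y * x = 1 \<Longrightarrow> cliff_inv x = y"
  unfolding cliff_inv_def by (rule the_equality) (auto, metis mult.assoc mult_1_left mult_1_right)

lemma cliff_inv_spin: "cliff_inv (spin \<theta>) = spin (- \<theta>)"
  by (rule cliff_inv_unique) (simp_all add: spin_mult)

lemma spin_conj_vec: "spin \<theta> * cliff_vec x * spin (- \<theta>) =
    cliff_vec (vector [cos (2 * \<theta>) * x $ 1 - sin (2 * \<theta>) * x $ 2,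
                 sin (2 * \<theta>) * x $ 1 + cos (2 * \<theta>) * x $ 2])"
  unfolding cos_double sin_double
  by (simp add: spin_eq cliff_vec_eq times_cliff2_def power2_eq_square) (simp add: algebra_simps)

lemma cliff_vec_unvec_conj:
  assumes "s \<in> Spin2"
  shows "cliff_vec (cliff_unvec (s * cliff_vec x * cliff_inv s)) = s * cliff_vec x * cliff_inv s"
    and "cliff_vec (cliff_unvec (cliff_inv s * cliff_vec x * s)) = cliff_inv s * cliff_vec x * s"
proof -
  from assms obtain \<theta> where s: "s = spin \<theta>" by (auto simp: Spin2_def)
  show "cliff_vec (cliff_unvec (s * cliff_vec x * cliff_inv s)) = s * cliff_vec x * cliff_inv s"
    unfolding s cliff_inv_spin spin_conj_vec by simp
  show "cliff_vec (cliff_unvec (cliff_inv s * cliff_vec x * s)) = cliff_inv s * cliff_vec x * s"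
    using spin_conj_vec[of "- \<theta>" x] unfolding s cliff_inv_spin by simp
qed

text \<open>The element \<open>s\<^sub>\<omega>\<close>; it is only used for unit vectors \<open>\<omega>\<close>.\<close>

definition spin_of :: "real^2 \<Rightarrow> cliff2" where
  "spin_of \<omega> = (THE s. (\<exists>\<phi>. 0 \<le> \<phi> \<and> \<phi> < pi \<and> s = spin \<phi>) \<and> s * e\<^sub>2 * cliff_inv s = cliff_vec \<omega>)"

lemma spin_of_eq:
  assumes "0 \<le> \<phi>" "\<phi> < pi"
  shows "spin_of (vector [- sin (2 * \<phi>), cos (2 * \<phi>)]) = spin \<phi>"
proof -
  have e2: "e\<^sub>2 = cliff_vec (vector [0, 1])"
    by (simp add: cliff_vec_eq e2_def)
  show ?thesis
    unfolding spin_of_def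
  proof (rule the_equality, safe)
    show "\<exists>\<phi>'. 0 \<le> \<phi>' \<and> \<phi>' < pi \<and> spin \<phi> = spin \<phi>'" using assms by blast
    show "spin \<phi> * e\<^sub>2 * cliff_inv (spin \<phi>) = cliff_vec (vector [- sin (2 * \<phi>), cos (2 * \<phi>)])"
      unfolding cliff_inv_spin e2 spin_conj_vec by simp
  next
    fix \<psi> assume \<psi>: "0 \<le> \<psi>" "\<psi> < pi"
      and *: "spin \<psi> * e\<^sub>2 * cliff_inv (spin \<psi>) = cliff_vec (vector [- sin (2 * \<phi>), cos (2 * \<phi>)])"
    have "sin (2 * \<psi>) = sin (2 * \<phi>)" "cos (2 * \<psi>) = cos (2 * \<phi>)"
      using * unfolding cliff_inv_spin e2 spin_conj_vec by (simp_all add: cliff_vec_eq)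
    then obtain n :: int where n: "2 * \<psi> = 2 * \<phi> + 2 * pi * n"
      using sin_cos_eq_iff by blast
    hence "pi * real_of_int n < pi * 1" "pi * real_of_int n > pi * (- 1)"
      using \<psi> assms by linarith+
    hence "n = 0"
      by (simp only: mult_less_cancel_left_pos[OF pi_gt_zero])
    hence "\<psi> = \<phi>"
      using n by simp
    thus "spin \<psi> = spin \<phi>" by simp
  qed
qed

section \<open>The group \<open>r Spin(2) + \<real>\<^sup>2\<close> and its action on Clifford-valued functions\<close>

definition spin_sim :: "(real \<times> cliff2 \<times> (real^2)) monoid" where
  "spin_sim =
    \<lparr>carrier = {0<..} \<times> Spin2 \<times> UNIV,
     mult = (\<lambda>(r, s, b) (r', s', b').
       (r * r', s * s', r *\<^sub>R cliff_unvec (s * cliff_vec b' * cliff_inv s) + b)),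
     one = (1, 1, 0)\<rparr>"

lemma group_spin_sim: "group spin_sim"
proof -
  have act: "cliff_unvec (spin \<theta> * cliff_vec x * cliff_inv (spin \<theta>)) =
      vector [cos (2 * \<theta>) * x $ 1 - sin (2 * \<theta>) * x $ 2,
              sin (2 * \<theta>) * x $ 1 + cos (2 * \<theta>) * x $ 2]" for \<theta> x
    by (simp add: cliff_inv_spin spin_conj_vec)
  show ?thesis
  proof (rule groupI)
    fix g h k assume "g \<in> carrier spin_sim" "h \<in> carrier spin_sim" "k \<in> carrier spin_sim"
    then obtain r \<theta> b r' \<theta>' b' r'' \<theta>'' b'' where
      "g = (r, spin \<theta>, b)" "h = (r', spin \<theta>', b')" "k = (r'', spin \<theta>'', b'')"
      by (auto simp: spin_sim_def Spin2_def)
    thus "g \<otimes>\<^bsub>spin_sim\<^esub> h \<otimes>\<^bsub>spin_sim\<^esub> k = g \<otimes>\<^bsub>spin_sim\<^esub> (h \<otimes>\<^bsub>spin_sim\<^esub> k)"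
      by (simp add: spin_sim_def spin_mult act vec_eq_iff forall_2 distrib_left cos_add sin_add)
        (simp add: algebra_simps)
  next
    fix g assume "g \<in> carrier spin_sim"
    then obtain r \<theta> b where g: "g = (r, spin \<theta>, b)" "r > 0"
      by (auto simp: spin_sim_def Spin2_def)
    show "\<one>\<^bsub>spin_sim\<^esub> \<otimes>\<^bsub>spin_sim\<^esub> g = g"
      using act[of 0 b] by (simp add: spin_sim_def g vec_eq_iff forall_2)
    let ?h = "(1 / r, spin (- \<theta>),
      - (1 / r) *\<^sub>R cliff_unvec (spin (- \<theta>) * cliff_vec b * cliff_inv (spin (- \<theta>))))"
    have "?h \<otimes>\<^bsub>spin_sim\<^esub> g = \<one>\<^bsub>spin_sim\<^esub>"
      using g by (simp add: spin_sim_def spin_mult)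
    moreover have "?h \<in> carrier spin_sim"
      using g by (simp add: spin_sim_def Spin2_def)
    ultimately show "\<exists>h\<in>carrier spin_sim. h \<otimes>\<^bsub>spin_sim\<^esub> g = \<one>\<^bsub>spin_sim\<^esub>"
      by blast
  qed (auto simp: spin_sim_def Spin2_def spin_mult simp flip: spin_0)
qed

definition sim_fun ::
  "real \<times> cliff2 \<times> (real^2) \<Rightarrow> (real^2 \<Rightarrow> cliff2) \<Rightarrow> (real^2 \<Rightarrow> cliff2)" where
  "sim_fun = (\<lambda>(r, s, b) g y.
     exp (\<i> * 2 * pi * (b \<bullet> y)) *\<^sub>C r *\<^sub>R (s * g (r *\<^sub>R cliff_unvec (cliff_inv s * cliff_vec y * s))))"

text \<open>The induced operator on classes modulo almost everywhere equality. For group elements it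
  does not depend on the representative chosen, see \<open>sim_rep_abs\<close> below.\<close>

definition sim_rep ::
  "real \<times> cliff2 \<times> (real^2) \<Rightarrow> (real^2, cliff2) L2 \<Rightarrow> (real^2, cliff2) L2" where
  "sim_rep g F = abs_L2 (sim_fun g (rep_L2 F))"

definition sim_map :: "real \<Rightarrow> cliff2 \<Rightarrow> real^2 \<Rightarrow> real^2" where
  "sim_map r s y = r *\<^sub>R cliff_unvec (cliff_inv s * cliff_vec y * s)"

lemma sim_map_spin: "sim_map r (spin \<theta>) y =
    vector [r * (cos (2 * \<theta>) * y $ 1 + sin (2 * \<theta>) * y $ 2),
            r * (cos (2 * \<theta>) * y $ 2 - sin (2 * \<theta>) * y $ 1)]"
  using spin_conj_vec[of "- \<theta>" y]
  by (simp add: sim_map_def cliff_inv_spin vec_eq_iff forall_2)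

lemma linear_sim_map: "linear (sim_map r (spin \<theta>))"
  by (rule linearI) (simp_all add: sim_map_spin vec_eq_iff forall_2 algebra_simps)

lemma sim_map_inverse:
  assumes "r > 0"
  shows "sim_map r (spin \<theta>) (sim_map (1 / r) (spin (- \<theta>)) y) = y"
proof -
  let ?c = "cos (2 * \<theta>)" and ?s = "sin (2 * \<theta>)"
  have "?c * ?c + ?s * ?s = 1"
    using sin_cos_squared_add2[of "2 * \<theta>"] by (simp add: power2_eq_square)
  hence sc: "?c * (?c * p) + ?s * (?s * p) = p" for p
    by (metis distrib_right mult.assoc mult_1_left)
  have r: "r * (x * (1 / r * p) + y * (1 / r * q)) = x * p + y * q"
    "r * (x * (1 / r * p) - y * (1 / r * q)) = x * p - y * q" for x y p q
    using assms by (simp_all add: field_simps)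
  have "sim_map r (spin \<theta>) (sim_map (1 / r) (spin (- \<theta>)) y) =
     vector [?c * (?c * y $ 1 - ?s * y $ 2) + ?s * (?c * y $ 2 + ?s * y $ 1),
             ?c * (?c * y $ 2 + ?s * y $ 1) - ?s * (?c * y $ 1 - ?s * y $ 2)]"
    by (simp only: sim_map_spin vector_2 r) simp
  also have "\<dots> = y"
    by (simp add: vec_eq_iff forall_2 right_diff_distrib distrib_left sc mult.left_commute[of ?c ?s])
  finally show ?thesis .
qed

lemma det_sim_map: "det (matrix (sim_map r (spin \<theta>))) = r\<^sup>2"
proof -
  have "det (matrix (sim_map r (spin \<theta>))) =
      r * cos (2 * \<theta>) * (r * cos (2 * \<theta>)) + r * sin (2 * \<theta>) * (r * sin (2 * \<theta>))"
    by (simp add: det_2 matrix_def sim_map_spin axis_def)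
  also have "\<dots> = r\<^sup>2 * ((cos (2 * \<theta>))\<^sup>2 + (sin (2 * \<theta>))\<^sup>2)"
    by (simp only: power2_eq_square distrib_left mult_ac)
  finally show ?thesis by simp
qed

lemma lborel_sim_map:
  assumes r: "r > 0"
  shows "lborel = density (distr lborel borel (sim_map r (spin \<theta>))) (\<lambda>_. ennreal (r\<^sup>2))"
proof (rule lborel_eqI)
  let ?T = "sim_map r (spin \<theta>)" and ?S = "sim_map (1 / r) (spin (- \<theta>))"
  have T [measurable]: "?T \<in> borel \<rightarrow>\<^sub>M borel"
    by (intro borel_measurable_continuous_onI linear_continuous_on linear_sim_map
        linear_conv_bounded_linear[THEN iffD1])
  have ST: "?S (?T y) = y" for y
    using sim_map_inverse[of "1 / r" "- \<theta>" y] r by simp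
  fix l u :: "real^2" assume lu: "\<And>b. b \<in> Basis \<Longrightarrow> l \<bullet> b \<le> u \<bullet> b"
  have im: "?T -` box l u = ?S ` box l u"
    using sim_map_inverse[OF r, of \<theta>] ST by (auto simp: image_iff) metis
  have box: "?S ` box l u \<in> lmeasurable"
    "measure lebesgue (?S ` box l u) = \<bar>det (matrix ?S)\<bar> * measure lebesgue (box l u)"
    using measurable_linear_image[OF linear_sim_map lmeasurable_box]
      measure_linear_image[OF linear_sim_map lmeasurable_box] by blast+
  have "emeasure lborel (?T -` box l u) = emeasure lebesgue (?T -` box l u)"
    using measurable_sets[OF T, of "box l u"] by (simp add: emeasure_completion)
  also have "\<dots> = ennreal (measure lebesgue (?S ` box l u))"
    unfolding im using box(1) by (simp add: emeasure_eq_measure2)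
  also have "\<dots> = ennreal (1 / r\<^sup>2 * (\<Prod>b\<in>Basis. (u - l) \<bullet> b))"
    unfolding box(2) det_sim_map using lu
    by (simp add: power_divide measure_lborel_box_eq)
  finally have *: "emeasure lborel (?T -` box l u) = ennreal (1 / r\<^sup>2 * (\<Prod>b\<in>Basis. (u - l) \<bullet> b))" .
  show "emeasure (density (distr lborel borel ?T) (\<lambda>_. ennreal (r\<^sup>2))) (box l u) =
      (\<Prod>b\<in>Basis. (u - l) \<bullet> b)"
    using r lu by (simp add: emeasure_density nn_integral_cmult emeasure_distr * 
        prod_nonneg inner_diff_left flip: ennreal_mult')
qed simp

lemma norm_spin_mult: "norm (spin \<theta> * x) = norm x"
proof -
  have *: "inner (Cliff (complex_of_real a) 0 0 (complex_of_real b) * x)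
      (Cliff (complex_of_real a) 0 0 (complex_of_real b) * x) = (a * a + b * b) * inner x x" for a b
    by (simp add: inner_cliff2_def cinner_cliff2_def times_cliff2_def algebra_simps)
  have "inner (spin \<theta> * x) (spin \<theta> * x) = ((cos \<theta>)\<^sup>2 + (sin \<theta>)\<^sup>2) * inner x x"
    unfolding spin_eq * power2_eq_square ..
  thus ?thesis by (simp add: norm_cliff2_def)
qed

lemma borel_measurable_Cliff:
  assumes [measurable]: "a \<in> borel_measurable M" "b \<in> borel_measurable M"
    "c \<in> borel_measurable M" "d \<in> borel_measurable M"
  shows "(\<lambda>x. Cliff (a x) (b x) (c x) (d x)) \<in> borel_measurable M"
proof (subst borel_measurable_euclidean_space, intro ballI)
  fix i :: cliff2 assume "i \<in> Basis"
  show "(\<lambda>x. Cliff (a x) (b x) (c x) (d x) \<bullet> i) \<in> borel_measurable M"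
    unfolding inner_commute[of _ i] unfolding inner_cliff2_def cinner_cliff2_def cliff2.sel
    by measurable
qed

lemma borel_measurable_cf:
  assumes [measurable]: "f \<in> borel_measurable M"
  shows "(\<lambda>x. cf_0 (f x)) \<in> borel_measurable M" "(\<lambda>x. cf_1 (f x)) \<in> borel_measurable M"
    "(\<lambda>x. cf_2 (f x)) \<in> borel_measurable M" "(\<lambda>x. cf_12 (f x)) \<in> borel_measurable M"
proof -
  have "cf_0 x = cinner (Cliff 1 0 0 0) x" "cf_1 x = cinner (Cliff 0 1 0 0) x"
    "cf_2 x = cinner (Cliff 0 0 1 0) x" "cf_12 x = cinner (Cliff 0 0 0 1) x" for x
    by (simp_all add: cinner_cliff2_def)
  thus "(\<lambda>x. cf_0 (f x)) \<in> borel_measurable M" "(\<lambda>x. cf_1 (f x)) \<in> borel_measurable M"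
    "(\<lambda>x. cf_2 (f x)) \<in> borel_measurable M" "(\<lambda>x. cf_12 (f x)) \<in> borel_measurable M"
    by simp_all
qed

lemma borel_measurable_cliff_mult [measurable]:
  fixes f g :: "'a \<Rightarrow> cliff2"
  assumes "f \<in> borel_measurable M" "g \<in> borel_measurable M"
  shows "(\<lambda>x. f x * g x) \<in> borel_measurable M"
  unfolding times_cliff2_def
  by (intro borel_measurable_Cliff borel_measurable_add borel_measurable_diff
      borel_measurable_times borel_measurable_cf assms)

lemma borel_measurable_scaleC_fun [measurable]:
  fixes f :: "'a \<Rightarrow> cliff2" and c :: "'a \<Rightarrow> complex"
  assumes "f \<in> borel_measurable M" "c \<in> borel_measurable M"
  shows "(\<lambda>x. c x *\<^sub>C f x) \<in> borel_measurable M"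
  unfolding scaleC_cliff2_def
  by (intro borel_measurable_Cliff borel_measurable_times borel_measurable_cf assms)

lemma sim_fun_L2_eq:
  assumes g: "g \<in> carrier spin_sim" and "L2_eq f f'"
  shows "L2_eq (sim_fun g f) (sim_fun g f')"
proof -
  obtain r \<theta> b where g: "g = (r, spin \<theta>, b)" and r: "r > 0"
    using assms by (auto simp: spin_sim_def Spin2_def)
  let ?T = "sim_map r (spin \<theta>)"
  have T [measurable]: "?T \<in> borel \<rightarrow>\<^sub>M borel"
    by (intro borel_measurable_continuous_onI linear_continuous_on linear_sim_map
        linear_conv_bounded_linear[THEN iffD1])
  have sim: "sim_fun g h =
      (\<lambda>y. exp (\<i> * 2 * pi * (b \<bullet> y)) *\<^sub>C r *\<^sub>R (spin \<theta> * h (?T y)))" for h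
    by (simp add: g sim_fun_def sim_map_def fun_eq_iff)
  have L2: "sim_fun g h \<in> L2_fun" if "h \<in> L2_fun" for h
  proof -
    have h [measurable]: "h \<in> borel_measurable borel"
      and I: "integrable lborel (\<lambda>y. (norm (h y))\<^sup>2)"
      using that by (auto simp: L2_fun_def)
    have m: "sim_fun g h \<in> borel_measurable lborel"
      unfolding sim by measurable
    have "integrable (density (distr lborel borel ?T) (\<lambda>_. ennreal (r\<^sup>2))) (\<lambda>y. (norm (h y))\<^sup>2)"
      using I lborel_sim_map[OF r, of \<theta>] by simp
    hence "integrable lborel (\<lambda>y. r\<^sup>2 * (norm (h (?T y)))\<^sup>2)"
      using r by (simp add: integrable_density integrable_distr_eq)
    moreover have "(norm (sim_fun g h y))\<^sup>2 = r\<^sup>2 * (norm (h (?T y)))\<^sup>2" for y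
    proof -
      have "norm (exp (\<i> * 2 * pi * (b \<bullet> y))) = 1"
        by (simp add: norm_exp_eq_Re)
      thus ?thesis unfolding sim by (simp add: norm_spin_mult power_mult_distrib)
    qed
    ultimately show ?thesis using m by (simp add: L2_fun_def)
  qed
  have "AE y in density (distr lborel borel ?T) (\<lambda>_. ennreal (r\<^sup>2)). f y = f' y"
    unfolding lborel_sim_map[OF r, of \<theta>, symmetric] using assms by (simp add: L2_eq_def)
  moreover have [measurable]: "f \<in> borel_measurable borel" "f' \<in> borel_measurable borel"
    using assms by (auto simp: L2_eq_def L2_fun_def)
  ultimately have "AE y in lborel. f (?T y) = f' (?T y)"
    using r by (simp add: AE_density AE_distr_iff)
  hence "AE y in lborel. sim_fun g f y = sim_fun g f' y"
    by eventually_elim (simp add: sim)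
  moreover have "f \<in> L2_fun" "f' \<in> L2_fun"
    using assms by (simp_all add: L2_eq_def)
  ultimately show ?thesis
    using L2 by (simp add: L2_eq_def)
qed

lemma sim_rep_abs:
  assumes "g \<in> carrier spin_sim" "f \<in> L2_fun"
  shows "sim_rep g (abs_L2 f) = abs_L2 (sim_fun g f)"
proof -
  have "L2_eq f f" using assms by (simp add: L2_eq_def)
  hence "L2_eq (rep_L2 (abs_L2 f)) f"
    by (rule Quotient_rep_abs[OF Quotient_L2])
  hence "L2_eq (sim_fun g (rep_L2 (abs_L2 f))) (sim_fun g f)"
    by (rule sim_fun_L2_eq[OF assms(1)])
  thus ?thesis
    unfolding sim_rep_def by (rule Quotient_rel_abs[OF Quotient_L2])
qed

section \<open>The representation spaces\<close>

text \<open>The function \<open>s\<^bsub>y/|y|\<^esub> \<alpha>(y) c\<close>. Its value at \<open>y = 0\<close>, where \<open>y/|y|\<close> makes no sense,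
  is irrelevant for the class in \<open>L\<^sup>2\<close>.\<close>

definition spin_twist :: "cliff2 \<Rightarrow> (real^2 \<Rightarrow> complex) \<Rightarrow> real^2 \<Rightarrow> cliff2" where
  "spin_twist c \<alpha> y = spin_of (y /\<^sub>R norm y) * \<alpha> y *\<^sub>C c"

definition H_minus :: "(real^2, cliff2) L2 set" where
  "H_minus = {abs_L2 (spin_twist (e\<^sub>1 + \<i> *\<^sub>C e\<^sub>2 + 1 - \<i> *\<^sub>C (e\<^sub>1 * e\<^sub>2)) \<alpha>) |\<alpha>. \<alpha> \<in> L2_fun}"

definition H_plus :: "(real^2, cliff2) L2 set" where
  "H_plus = {abs_L2 (spin_twist (e\<^sub>1 + \<i> *\<^sub>C e\<^sub>2 - (1 - \<i> *\<^sub>C (e\<^sub>1 * e\<^sub>2))) \<alpha>) |\<alpha>. \<alpha> \<in> L2_fun}"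

lemma spin_of_unit_aux:
  assumes "norm \<omega> = 1"
  shows "\<exists>\<phi>. spin_of \<omega> = spin \<phi>" (is ?ex) and "spin_of \<omega> = Cliff ((if \<omega> $ 1 \<le> 0 then 1 else - 1) * sqrt ((1 + \<omega> $ 2) / 2)) 0 0
    (sqrt ((1 - \<omega> $ 2) / 2))" (is ?eq)
proof -
  have n: "(\<omega> $ 1)\<^sup>2 + (\<omega> $ 2)\<^sup>2 = 1"
    using assms by (simp add: norm_vec_def L2_set_def sum_2)
  hence "(- \<omega> $ 1)\<^sup>2 + (\<omega> $ 2)\<^sup>2 = 1" by simp
  then obtain t where t: "0 \<le> t" "t < 2 * pi" "- \<omega> $ 1 = sin t" "\<omega> $ 2 = cos t"
    using sincos_total_2pi[of "\<omega> $ 2" "- \<omega> $ 1"] by (auto simp: add.commute)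
  define \<phi> where "\<phi> = t / 2"
  have \<phi>: "0 \<le> \<phi>" "\<phi> < pi" "\<omega> $ 1 = - sin (2 * \<phi>)" "\<omega> $ 2 = cos (2 * \<phi>)"
    using t by (auto simp: \<phi>_def)
  have \<omega>: "\<omega> = vector [- sin (2 * \<phi>), cos (2 * \<phi>)]"
    using \<phi> by (simp add: vec_eq_iff forall_2)
  have s: "sin \<phi> \<ge> 0" using \<phi> by (intro sin_ge_zero) auto
  have "(1 - \<omega> $ 2) / 2 = (sin \<phi>)\<^sup>2"
    unfolding \<phi>(4) cos_double_sin by simp
  moreover have "(1 + \<omega> $ 2) / 2 = (cos \<phi>)\<^sup>2"
    unfolding \<phi>(4) cos_double_cos by simp
  ultimately have 1: "sqrt ((1 - \<omega> $ 2) / 2) = sin \<phi>" "sqrt ((1 + \<omega> $ 2) / 2) = \<bar>cos \<phi>\<bar>"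
    using s by simp_all
  have "(if \<omega> $ 1 \<le> 0 then 1 else - 1) * \<bar>cos \<phi>\<bar> = cos \<phi>"
  proof (cases "\<phi> = 0")
    case False
    hence "sin \<phi> > 0" using \<phi> by (intro sin_gt_zero) auto
    thus ?thesis
      unfolding \<phi>(3) sin_double by (auto simp: zero_le_mult_iff)
  qed (use \<phi> in simp)
  hence "Cliff ((if \<omega> $ 1 \<le> 0 then 1 else - 1) * sqrt ((1 + \<omega> $ 2) / 2)) 0 0
    (sqrt ((1 - \<omega> $ 2) / 2)) = spin \<phi>"
    unfolding 1 spin_eq by (metis of_real_mult of_real_1 of_real_minus)
  moreover have "spin_of \<omega> = spin \<phi>"
    unfolding \<omega> by (rule spin_of_eq) (use \<phi> in auto)
  ultimately show ?ex ?eq by auto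
qed

lemmas spin_of_unit_ex = spin_of_unit_aux(1) and spin_of_unit = spin_of_unit_aux(2)

lemma spin_twist_L2_fun:
  assumes \<alpha>: "\<alpha> \<in> L2_fun"
  shows "spin_twist c \<alpha> \<in> L2_fun"
proof -
  define h where "h y = (if y = 0 then spin_of 0 else
      Cliff ((if y $ 1 \<le> 0 then 1 else - 1) * sqrt ((1 + y $ 2 / norm y) / 2)) 0 0
        (sqrt ((1 - y $ 2 / norm y) / 2)))" for y :: "real^2"
  have h: "spin_of (y /\<^sub>R norm y) = h y" for y :: "real^2"
  proof (cases "y = 0")
    case False
    hence "norm (y /\<^sub>R norm y) = 1" by simp
    moreover have "(y /\<^sub>R norm y) $ 2 = y $ 2 / norm y"
      by (simp add: divide_inverse mult.commute)
    moreover have "inverse (norm y) > 0" using False by simp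
    hence "(y /\<^sub>R norm y) $ 1 \<le> 0 \<longleftrightarrow> y $ 1 \<le> 0"
      by (simp only: vector_scaleR_component real_scaleR_def mult_le_0_iff) linarith
    ultimately show ?thesis
      using False by (simp only: spin_of_unit h_def if_False)
  qed (simp add: h_def)
  have comp [measurable]: "(\<lambda>y. y $ i) \<in> borel_measurable borel" for i :: 2
    by (intro borel_measurable_continuous_onI continuous_intros)
  have [measurable]: "h \<in> borel_measurable borel"
    unfolding h_def[abs_def]
    by (intro measurable_If borel_measurable_Cliff) measurable
  have \<alpha>' [measurable]: "\<alpha> \<in> borel_measurable borel"
    and I: "integrable lborel (\<lambda>y. (cmod (\<alpha> y))\<^sup>2)"
    using \<alpha> by (auto simp: L2_fun_def)
  have m [measurable]: "spin_twist c \<alpha> \<in> borel_measurable borel"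
    unfolding spin_twist_def[abs_def] h by measurable
  have n: "norm (spin_twist c \<alpha> y) = cmod (\<alpha> y) * norm c" if "y \<noteq> 0" for y
  proof -
    have "norm (y /\<^sub>R norm y) = 1" using that by simp
    then obtain \<phi> where "spin_of (y /\<^sub>R norm y) = spin \<phi>"
      using spin_of_unit_ex by blast
    thus ?thesis by (simp add: spin_twist_def norm_spin_mult)
  qed
  have "integrable lborel (\<lambda>y. (cmod (\<alpha> y))\<^sup>2 * (norm c)\<^sup>2)"
    using I by simp
  moreover have "(\<lambda>y. (norm (spin_twist c \<alpha> y))\<^sup>2) \<in> borel_measurable lborel"
    using m by simp
  moreover have "AE y in lborel. (cmod (\<alpha> y))\<^sup>2 * (norm c)\<^sup>2 = (norm (spin_twist c \<alpha> y))\<^sup>2"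
    using AE_lborel_singleton[of "0 :: real^2"] by eventually_elim (simp add: n power_mult_distrib)
  ultimately have "integrable lborel (\<lambda>y. (norm (spin_twist c \<alpha> y))\<^sup>2)"
    by (rule integrable_cong_AE_imp)
  thus ?thesis by (simp add: L2_fun_def)
qed

end

theory Submission
  imports Defs
begin

text \<open>
  The constants \<open>e\<^sub>1 + i e\<^sub>2 \<plusminus> (1 - i e\<^sub>1e\<^sub>2)\<close> are common eigenvectors of left multiplication by \<open>e\<^sub>2\<close> and of
  right multiplication by \<open>e\<^sub>1e\<^sub>2\<close>. Hence the two spaces consist of the \<open>f \<in> L\<^sup>2\<close> with
  \<open>f(y) e\<^sub>1e\<^sub>2 = i f(y)\<close> and \<open>y f(y) = \<minusplus> i |y| f(y)\<close> almost everywhere, conditions which are visibly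
  closed and invariant under the group. For irreducibility let \<open>F \<noteq> 0\<close> lie in a closed
  invariant subspace and \<open>G \<noteq> 0\<close> be orthogonal to it. By uniqueness of the Fourier transform,
  orthogonality to all translates of \<open>F\<close> means that \<open>G(y)\<close> and \<open>s F(r s\<^sup>-\<^sup>1 y s)\<close> are orthogonal for
  almost every \<open>y\<close>; as both lie on the same complex line, one of them vanishes. Since similitudes act
  transitively on nonzero vectors, Fubini's theorem yields a contradiction. Changing the sign of the
  even part commutes with left multiplication by the spin group and intertwines the two representations.
\<close>

section \<open>Uniqueness of the Fourier transform of integrable functions\<close>

text \<open>These are the integrable functions whose Fourier transform vanishes identically.
  Treating them as a set allows one to prove stability under multiplication by ever larger classes
  of bounded functions, ending with indicators.\<close>

definition fourier_null :: "('a::euclidean_space \<Rightarrow> complex) set" where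
  "fourier_null = {h. integrable lborel h \<and> (\<forall>b. (LINT y|lborel. cis (b \<bullet> y) * h y) = 0)}"

lemma borel_measurable_cis [measurable]:
  "f \<in> borel_measurable M \<Longrightarrow> (\<lambda>x. cis (f x)) \<in> borel_measurable M"
  by (rule borel_measurable_continuous_on[where f = cis]) (auto intro!: continuous_intros)

section \<open>Stability of vanishing Fourier transforms under trigonometric multipliers\<close>

lemma integrable_bounded_mult:
  fixes h \<phi> :: "'a::euclidean_space \<Rightarrow> complex"
  assumes h: "integrable lborel h" and [measurable]: "\<phi> \<in> borel_measurable borel"
    and le: "\<And>y. cmod (\<phi> y) \<le> K"
  shows "integrable lborel (\<lambda>y. \<phi> y * h y)"
proof (rule Bochner_Integration.integrable_bound)
  have [measurable]: "h \<in> borel_measurable borel" using h by auto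
  show "(\<lambda>y. \<phi> y * h y) \<in> borel_measurable lborel" by simp
  show "integrable lborel (\<lambda>y. K * cmod (h y))" using h by simp
  have "K \<ge> 0" using le[of undefined] norm_ge_zero order_trans by blast
  thus "AE y in lborel. norm (\<phi> y * h y) \<le> norm (K * cmod (h y))"
    by (auto simp: norm_mult intro!: mult_right_mono le)
qed

text \<open>Modulation by the frequency \<open>b\<close> only translates the Fourier transform by
  \<open>b\<close>.\<close>

lemma fourier_null_cis:
  assumes "h \<in> fourier_null"
  shows "(\<lambda>y. cis (b \<bullet> y) * h y) \<in> fourier_null"
proof -
  have I: "integrable lborel (\<lambda>y. cis (b \<bullet> y) * h y)"
    using assms by (intro integrable_bounded_mult[where K = 1]) (auto simp: fourier_null_def)
  have *: "cis (c \<bullet> y) * (cis (b \<bullet> y) * h y) = cis ((c + b) \<bullet> y) * h y" for c y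
    unfolding mult.assoc[symmetric] cis_mult inner_add_left ..
  have "(LINT y|lborel. cis (c \<bullet> y) * (cis (b \<bullet> y) * h y)) = 0" for c
    unfolding * using assms by (simp add: fourier_null_def)
  thus ?thesis using I by (simp add: fourier_null_def)
qed

lemma fourier_null_add:
  assumes "g \<in> fourier_null" "h \<in> fourier_null"
  shows "(\<lambda>y. g y + h y) \<in> fourier_null"
  \<comment> \<open>\<open>fourier_null_cis\<close> supplies the integrability of the modulated
    functions that is needed to split the integral of the sum.\<close>
  using assms fourier_null_cis[of g] fourier_null_cis[of h]
  by (auto simp: fourier_null_def distrib_left)

lemma fourier_null_cmult:
  assumes "h \<in> fourier_null"
  shows "(\<lambda>y. c * h y) \<in> fourier_null"
  using assms by (simp add: fourier_null_def mult.left_commute[of _ c])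

lemma fourier_null_sum:
  assumes "finite I" "\<And>i. i \<in> I \<Longrightarrow> g i \<in> fourier_null"
  shows "(\<lambda>y. \<Sum>i\<in>I. g i y) \<in> fourier_null"
  using assms
proof (induction rule: finite_induct)
  case empty
  show ?case by (simp add: fourier_null_def)
qed (simp add: fourier_null_add)

lemma fourier_null_sin:
  assumes "h \<in> fourier_null"
  shows "(\<lambda>y. complex_of_real (sin (b \<bullet> y)) * h y) \<in> fourier_null"
proof -
  have *: "complex_of_real (sin t) = - \<i> / 2 * cis t + \<i> / 2 * cis (- t)" for t
    by (simp add: complex_eq_iff)
  have "complex_of_real (sin (b \<bullet> y)) * h y =
      - \<i> / 2 * (cis (b \<bullet> y) * h y) + \<i> / 2 * (cis (- b \<bullet> y) * h y)" for y
    unfolding * by (simp only: distrib_right mult.assoc inner_minus_left)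
  thus ?thesis
    using assms by (simp only: fourier_null_add fourier_null_cmult fourier_null_cis)
qed

section \<open>Bounded periodic coordinates that converge to the identity\<close>

definition sin_vec :: "real \<Rightarrow> 'a::euclidean_space \<Rightarrow> 'a" where
  "sin_vec N y = (\<Sum>i\<in>Basis. (N * sin ((i \<bullet> y) / N)) *\<^sub>R i)"

lemma continuous_sin_vec: "continuous_on UNIV (sin_vec N)"
  unfolding sin_vec_def divide_inverse by (intro continuous_intros)

lemma norm_sin_vec_le: "norm (sin_vec N y :: 'a::euclidean_space) \<le> \<bar>N\<bar> * DIM('a)"
proof -
  have "norm (sin_vec N y) \<le> (\<Sum>i\<in>(Basis :: 'a set). \<bar>N\<bar>)"
    unfolding sin_vec_def
    by (rule order_trans[OF norm_sum sum_mono]) (auto simp: abs_mult intro: mult_left_le)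
  thus ?thesis by (simp add: mult.commute)
qed

text \<open>This is the derivative at 0 of the function sending t to sin (t * x), taken along the
  sequence 1 / (n + 1).\<close>

lemma tendsto_mult_sin_divide: "(\<lambda>n. real (Suc n) * sin (x / real (Suc n))) \<longlonglongrightarrow> x"
proof -
  have "((\<lambda>t. sin (t * x)) has_real_derivative x) (at 0)"
    by (auto intro!: derivative_eq_intros)
  hence "((\<lambda>t. sin (t * x) / t) \<longlongrightarrow> x) (at 0)"
    by (simp add: has_field_derivative_iff)
  moreover have "filterlim (\<lambda>n. 1 / real (Suc n)) (at 0) sequentially"
    unfolding filterlim_at using LIMSEQ_inverse_real_of_nat by (simp add: divide_inverse)
  ultimately have "(\<lambda>n. sin (1 / real (Suc n) * x) / (1 / real (Suc n))) \<longlonglongrightarrow> x"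
    by (rule filterlim_compose)
  thus ?thesis by (simp add: mult.commute)
qed

lemma tendsto_sin_vec: "(\<lambda>n. sin_vec (real (Suc n)) y) \<longlonglongrightarrow> y"
proof -
  have "(\<lambda>n. sin_vec (real (Suc n)) y) \<longlonglongrightarrow> (\<Sum>i\<in>Basis. (i \<bullet> y) *\<^sub>R i)"
    unfolding sin_vec_def by (intro tendsto_sum tendsto_scaleR tendsto_mult_sin_divide tendsto_const)
  thus ?thesis by (simp add: inner_commute[of _ y] euclidean_representation)
qed

text \<open>A linear function of \<open>sin_vec N y\<close> is a combination of sines of linear
  forms, so \<open>fourier_null_sin\<close> applies. Products need an arbitrary \<open>h\<close> in
  the induction: one factor is absorbed into \<open>h\<close> before the other is treated.\<close>

lemma fourier_null_polynomial:
  assumes "real_polynomial_function q" "h \<in> fourier_null"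
  shows "(\<lambda>y. complex_of_real (q (sin_vec N y)) * h y) \<in> fourier_null"
  using assms
proof (induction arbitrary: h rule: real_polynomial_function.induct)
  case (linear f)
  have "f (sin_vec N y) = (\<Sum>i\<in>Basis. N * f i * sin ((i /\<^sub>R N) \<bullet> y))" for y
    unfolding sin_vec_def linear_sum[OF bounded_linear.linear[OF linear(1)]]
    by (simp add: linear_cmul[OF bounded_linear.linear[OF linear(1)]] divide_inverse mult_ac)
  hence *: "complex_of_real (f (sin_vec N y)) * h y =
      (\<Sum>i\<in>Basis. complex_of_real (N * f i) * (complex_of_real (sin ((i /\<^sub>R N) \<bullet> y)) * h y))" for y
    by (simp add: sum_distrib_right mult.assoc)
  show ?case
    unfolding * by (intro fourier_null_sum fourier_null_cmult fourier_null_sin linear.prems) simp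
next
  case (add f g)
  then show ?case by (simp add: distrib_right fourier_null_add)
next
  case (mult f g)
  then show ?case by (simp add: mult.assoc)
qed (rule fourier_null_cmult)

section \<open>From trigonometric polynomials to continuous functions and indicators\<close>

text \<open>Dominated convergence applies with the majorant \<open>K * cmod (h y)\<close>, which is
  integrable because \<open>h\<close> is.\<close>

lemma fourier_null_limit:
  fixes \<phi> :: "nat \<Rightarrow> 'a::euclidean_space \<Rightarrow> real"
  assumes h: "h \<in> fourier_null" and \<phi>h: "\<And>n. (\<lambda>y. complex_of_real (\<phi> n y) * h y) \<in> fourier_null"
    and [measurable]: "\<And>n. \<phi> n \<in> borel_measurable borel"
    and K: "\<And>n y. \<bar>\<phi> n y\<bar> \<le> K" and lim: "\<And>y. (\<lambda>n. \<phi> n y) \<longlonglongrightarrow> \<psi> y"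
  shows "(\<lambda>y. complex_of_real (\<psi> y) * h y) \<in> fourier_null"
proof -
  have I: "integrable lborel h" using h by (simp add: fourier_null_def)
  have [measurable]: "h \<in> borel_measurable borel" using I by auto
  have [measurable]: "\<psi> \<in> borel_measurable borel"
    by (rule borel_measurable_LIMSEQ_metric[OF _ lim]) simp
  have "\<bar>\<psi> y\<bar> \<le> K" for y
    by (rule LIMSEQ_le_const2[OF tendsto_rabs[OF lim]]) (use K in auto)
  hence "integrable lborel (\<lambda>y. complex_of_real (\<psi> y) * h y)"
    using I by (intro integrable_bounded_mult[where K = K]) auto
  moreover have "(LINT y|lborel. cis (b \<bullet> y) * (complex_of_real (\<psi> y) * h y)) = 0" for b
  proof (rule LIMSEQ_unique)
    show "(\<lambda>n. LINT y|lborel. cis (b \<bullet> y) * (complex_of_real (\<phi> n y) * h y))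
        \<longlonglongrightarrow> (LINT y|lborel. cis (b \<bullet> y) * (complex_of_real (\<psi> y) * h y))"
    proof (rule integral_dominated_convergence)
      show "integrable lborel (\<lambda>y. K * cmod (h y))" using I by simp
      show "AE y in lborel. (\<lambda>n. cis (b \<bullet> y) * (complex_of_real (\<phi> n y) * h y))
          \<longlonglongrightarrow> cis (b \<bullet> y) * (complex_of_real (\<psi> y) * h y)"
        by (intro AE_I2 tendsto_intros lim)
      show "AE y in lborel. norm (cis (b \<bullet> y) * (complex_of_real (\<phi> n y) * h y)) \<le> K * cmod (h y)" for n
        by (auto simp: norm_mult intro!: mult_right_mono K)
    qed measurable
    show "(\<lambda>n. LINT y|lborel. cis (b \<bullet> y) * (complex_of_real (\<phi> n y) * h y)) \<longlonglongrightarrow> 0"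
      using \<phi>h by (simp add: fourier_null_def)
  qed
  ultimately show ?thesis by (simp add: fourier_null_def)
qed

text \<open>Polynomials in the bounded coordinates \<^term>\<open>sin_vec N\<close> are trigonometric polynomials, so
  approximating on a ball containing the range of \<^term>\<open>sin_vec N\<close> gives uniform control on the whole
  space, which approximation by polynomials in the coordinates themselves would not.\<close>

lemma fourier_null_continuous:
  fixes \<phi> :: "'a::euclidean_space \<Rightarrow> real"
  assumes h: "h \<in> fourier_null" and cont: "continuous_on UNIV \<phi>" and K: "\<And>y. \<bar>\<phi> y\<bar> \<le> K"
  shows "(\<lambda>y. complex_of_real (\<phi> y) * h y) \<in> fourier_null"
proof -
  define \<Psi> :: "nat \<Rightarrow> 'a \<Rightarrow> 'a" where "\<Psi> n = sin_vec (real (Suc n))" for n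
  define S :: "nat \<Rightarrow> 'a set" where "S n = cball 0 (real (Suc n) * DIM('a))" for n
  have \<Psi>S: "\<Psi> n y \<in> S n" for n y
    using norm_sin_vec_le[of "real (Suc n)" y] by (simp add: \<Psi>_def S_def)
  have "\<exists>q. real_polynomial_function q \<and> (\<forall>x\<in>S n. \<bar>\<phi> x - q x\<bar> < 1 / real (Suc n))" for n
    by (rule Stone_Weierstrass_real_polynomial_function[of "S n" \<phi> "1 / real (Suc n)"])
      (use continuous_on_subset[OF cont] in \<open>auto simp: S_def simp del: of_nat_Suc\<close>)
  then obtain q where q: "\<And>n. real_polynomial_function (q n)"
    and q\<phi>: "\<And>n x. x \<in> S n \<Longrightarrow> \<bar>\<phi> x - q n x\<bar> < 1 / real (Suc n)"
    by metis
  show ?thesis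
  \<comment> \<open>The bound \<open>K + 1\<close> works for all approximants because no
    approximation error exceeds 1.\<close>
  proof (rule fourier_null_limit[where \<phi> = "\<lambda>n y. q n (\<Psi> n y)" and K = "K + 1"])
    show "(\<lambda>y. complex_of_real (q n (\<Psi> n y)) * h y) \<in> fourier_null" for n
      unfolding \<Psi>_def by (rule fourier_null_polynomial[OF q h])
    show "(\<lambda>y. q n (\<Psi> n y)) \<in> borel_measurable borel" for n
    proof -
      have "continuous_on UNIV (q n)"
        using q[of n] by (intro continuous_on_polymonial_function) (simp flip: real_polynomial_function_eq)
      thus ?thesis
        unfolding \<Psi>_def
        by (intro borel_measurable_continuous_onI continuous_on_compose2[OF _ continuous_sin_vec]) auto
    qed
    show "\<bar>q n (\<Psi> n y)\<bar> \<le> K + 1" for n y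
    proof -
      have "1 / real (Suc n) \<le> 1" by simp
      thus ?thesis using q\<phi>[OF \<Psi>S, of n y] K[of "\<Psi> n y"] by linarith
    qed
    show "(\<lambda>n. q n (\<Psi> n y)) \<longlonglongrightarrow> \<phi> y" for y
    proof -
      have "(\<lambda>n. \<phi> (\<Psi> n y)) \<longlonglongrightarrow> \<phi> y"
        by (rule continuous_on_tendsto_compose[OF cont]) (use tendsto_sin_vec[of y] in \<open>auto simp: \<Psi>_def simp del: of_nat_Suc\<close>)
      moreover have "(\<lambda>n. q n (\<Psi> n y) - \<phi> (\<Psi> n y)) \<longlonglongrightarrow> 0"
      proof (rule Lim_null_comparison)
        show "\<forall>\<^sub>F n in sequentially. norm (q n (\<Psi> n y) - \<phi> (\<Psi> n y)) \<le> 1 / real (Suc n)"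
          using q\<phi>[OF \<Psi>S] by (auto simp: abs_minus_commute less_imp_le)
        show "(\<lambda>n. 1 / real (Suc n)) \<longlonglongrightarrow> 0"
          using LIMSEQ_inverse_real_of_nat by (simp add: divide_inverse)
      qed
      ultimately show ?thesis using tendsto_add by fastforce
    qed
  qed (rule h)
qed

text \<open>The induction runs over the sigma-algebra generated by the closed sets. It keeps
  \<open>h\<close> arbitrary so that indicators can be multiplied, as inclusion-exclusion for finite
  unions demands; countable unions are limits of finite ones.\<close>

lemma fourier_null_indicator:
  fixes A :: "'a::euclidean_space set"
  assumes "h \<in> fourier_null" "A \<in> sets borel"
  shows "(\<lambda>y. complex_of_real (indicator A y) * h y) \<in> fourier_null"
proof -
  have "A \<in> sigma_sets UNIV (Collect closed)"
    using assms(2) by (simp add: borel_eq_closed)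
  thus ?thesis
    using assms(1)
  proof (induction arbitrary: h rule: sigma_sets.induct)
    case (Basic C)
    show ?case
    \<comment> \<open>By convention \<open>infdist\<close> to the empty set is 0, so the
      approximation used below would converge to 1 instead of 0.\<close>
    proof (cases "C = {}")
      case False
      show ?thesis
      \<comment> \<open>These continuous functions equal 1 on \<open>C\<close> and are eventually 0
        at each point outside it, since such a point has positive distance to the closed set
        \<open>C\<close>.\<close>
      proof (rule fourier_null_limit[where \<phi> = "\<lambda>n y. max 0 (1 - real n * infdist y C)" and K = 1])
        show "(\<lambda>y. complex_of_real (max 0 (1 - real n * infdist y C)) * h y) \<in> fourier_null" for n
          by (rule fourier_null_continuous[OF Basic.prems, of _ 1])
            (auto intro!: continuous_intros simp: infdist_nonneg)
        show "(\<lambda>n. max 0 (1 - real n * infdist y C)) \<longlonglongrightarrow> indicator C y" for y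
        proof (cases "y \<in> C")
          case y: False
          hence "infdist y C > 0"
            using in_closed_iff_infdist_zero[of C y] False Basic.hyps infdist_nonneg[of y C]
            by (force simp: less_le)
          hence "filterlim (\<lambda>n. real n * infdist y C) at_top sequentially"
            by (intro filterlim_at_top_mult_tendsto_pos[OF tendsto_const] filterlim_real_sequentially)
          hence "\<forall>\<^sub>F n in sequentially. real n * infdist y C \<ge> 1"
            by (simp add: filterlim_at_top)
          hence "\<forall>\<^sub>F n in sequentially. max 0 (1 - real n * infdist y C) = indicator C y"
            by eventually_elim (use y in auto)
          thus ?thesis by (rule tendsto_eventually)
        qed simp
      qed (use Basic.prems in \<open>auto simp: infdist_nonneg
          intro!: borel_measurable_continuous_onI continuous_intros\<close>)
    qed (simp add: fourier_null_def)
  next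
    case Empty
    show ?case by (simp add: fourier_null_def)
  next
    case (Compl A)
    have "complex_of_real (indicator (UNIV - A) y) * h y =
        h y + - 1 * (complex_of_real (indicator A y) * h y)" for y
      by (auto simp: indicator_def)
    thus ?case
      using Compl by (simp only: fourier_null_add fourier_null_cmult)
  next
    case (Union A)
    have A: "A n \<in> sets borel" for n
      using Union.hyps by (simp add: borel_eq_closed)
    have *: "(\<lambda>y. complex_of_real (indicator (\<Union>i<n. A i) y) * h y) \<in> fourier_null" for n
    proof (induction n)
      case 0
      show ?case by (simp add: fourier_null_def)
    next
      case (Suc n)
      let ?B = "\<Union>i<n. A i"
      have "complex_of_real (indicator (\<Union>i<Suc n. A i) y) * h y =
          complex_of_real (indicator ?B y) * h y + (complex_of_real (indicator (A n) y) * h y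
          + - 1 * (complex_of_real (indicator (A n) y) * (complex_of_real (indicator ?B y) * h y)))" for y
        by (auto simp: indicator_def lessThan_Suc)
      thus ?case
        by (simp only: fourier_null_add fourier_null_cmult Suc Union.IH Union.prems)
    qed
    show ?case
    proof (rule fourier_null_limit[OF Union.prems *, where K = 1])
      show "(\<lambda>n. indicator (\<Union>i<n. A i) y :: real) \<longlonglongrightarrow> indicator (\<Union> (range A)) y" for y
        by (rule LIMSEQ_indicator_UN)
    qed (use A in \<open>auto simp: indicator_def\<close>)
  qed
qed

text \<open>Frequency 0, applied to the product of \<open>h\<close> with an indicator, shows that
  \<open>h\<close> integrates to 0 over every Borel set. This forces its real and imaginary parts to
  vanish almost everywhere.\<close>

theorem fourier_null_AE_0:
  assumes h: "h \<in> fourier_null"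
  shows "AE y in lborel. h y = 0"
proof -
  have I: "integrable lborel h" using h by (simp add: fourier_null_def)
  have *: "(LINT y|lborel. indicator A y *\<^sub>R h y) = 0" if A: "A \<in> sets lborel" for A
    using fourier_null_indicator[OF h, of A] A
    by (auto simp: fourier_null_def scaleR_conv_of_real dest!: spec[of _ 0])
  have int: "integrable lborel (\<lambda>y. indicator A y *\<^sub>R h y)" if A: "A \<in> sets lborel" for A
    using I A by (rule integrable_mult_indicator[rotated])
  have "AE y in lborel. Re (h y) = 0"
    by (rule density_unique_real)
      (use I integral_Re[OF int] * in \<open>auto simp: set_lebesgue_integral_def\<close>)
  moreover have "AE y in lborel. Im (h y) = 0"
    by (rule density_unique_real)
      (use I integral_Im[OF int] * in \<open>auto simp: set_lebesgue_integral_def\<close>)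
  ultimately show ?thesis
    by eventually_elim (simp add: complex_eq_iff)
qed

section \<open>The Hilbert space \<open>L\<^sup>2\<close>\<close>

lemma rep_L2_fun: "rep_L2 F \<in> L2_fun"
  using Quotient_rep_reflp[OF Quotient_L2] by (auto simp: L2_eq_def)

lemma abs_rep_L2 [simp]: "abs_L2 (rep_L2 F) = F"
  by (rule Quotient_abs_rep[OF Quotient_L2])

lemma L2_eq_refl: "f \<in> L2_fun \<Longrightarrow> L2_eq f f"
  by (simp add: L2_eq_def)

lemma abs_L2_eq_iff:
  assumes "f \<in> L2_fun" "g \<in> L2_fun"
  shows "abs_L2 f = abs_L2 g \<longleftrightarrow> (AE x in lborel. f x = g x)"
  using Quotient_rel[OF Quotient_L2, of f g] assms by (auto simp: L2_eq_def)

lemma rep_abs_L2_AE: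
  assumes "f \<in> L2_fun"
  shows "AE x in lborel. rep_L2 (abs_L2 f) x = f x"
  using Quotient_rep_abs[OF Quotient_L2, OF L2_eq_refl[OF assms]] by (simp add: L2_eq_def)

lemma abs_L2_add:
  "f \<in> L2_fun \<Longrightarrow> g \<in> L2_fun \<Longrightarrow> abs_L2 f + abs_L2 g = abs_L2 (\<lambda>x. f x + g x)"
  by (intro plus_L2.abs_eq L2_eq_refl)

lemma abs_L2_diff:
  "f \<in> L2_fun \<Longrightarrow> g \<in> L2_fun \<Longrightarrow> abs_L2 f - abs_L2 g = abs_L2 (\<lambda>x. f x - g x)"
  by (intro minus_L2.abs_eq L2_eq_refl)

lemma abs_L2_scaleC: "f \<in> L2_fun \<Longrightarrow> c *\<^sub>C abs_L2 f = abs_L2 (\<lambda>x. c *\<^sub>C f x)"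
  by (intro scaleC_L2.abs_eq L2_eq_refl)

lemma cinner_abs_L2:
  "f \<in> L2_fun \<Longrightarrow> g \<in> L2_fun \<Longrightarrow>
    cinner (abs_L2 f) (abs_L2 g) = (LINT x|lborel. cinner (f x) (g x))"
  by (intro cinner_L2.abs_eq L2_eq_refl)

lemma norm_abs_L2:
  assumes "f \<in> L2_fun"
  shows "(norm (abs_L2 f))\<^sup>2 = (LINT x|lborel. (norm (f x))\<^sup>2)"
proof -
  have "complex_of_real ((norm (abs_L2 f))\<^sup>2) = complex_of_real (LINT x|lborel. (norm (f x))\<^sup>2)"
    using cinner_abs_L2[OF assms assms] unfolding cinner_self integral_complex_of_real .
  thus ?thesis by (simp only: of_real_eq_iff)
qed

lemma L2_cases:
  obtains f where "f \<in> L2_fun" "F = abs_L2 f"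
  using rep_L2_fun abs_rep_L2 by metis

lemma L2_fun_measurable: "f \<in> L2_fun \<Longrightarrow> f \<in> borel_measurable borel"
  by (simp add: L2_fun_def)

lemma nn_integral_norm_L2:
  assumes "f \<in> L2_fun"
  shows "(\<integral>\<^sup>+x. ennreal ((norm (f x))\<^sup>2) \<partial>lborel) = ennreal ((norm (abs_L2 f))\<^sup>2)"
  unfolding norm_abs_L2[OF assms] by (rule nn_integral_eq_integral) (use assms in \<open>auto simp: L2_fun_def\<close>)

lemma L2_funI:
  fixes f :: "'a::euclidean_space \<Rightarrow> 'b::{complex_inner, second_countable_topology}"
  assumes "f \<in> borel_measurable borel"
    and "(\<integral>\<^sup>+x. ennreal ((norm (f x))\<^sup>2) \<partial>lborel) < \<infinity>"
  shows "f \<in> L2_fun"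
  using assms by (simp add: L2_fun_def integrable_iff_bounded)

section \<open>Completeness of the space and closedness of pointwise conditions\<close>

lemma fast_Cauchy_subseq:
  fixes F :: "nat \<Rightarrow> 'a::metric_space"
  assumes "Cauchy F" and e: "\<And>n. e n > 0"
  obtains r where "strict_mono r" "\<And>n. dist (F (r (Suc n))) (F (r n)) < e n"
proof -
  have "\<forall>n. \<exists>N. \<forall>i\<ge>N. \<forall>j\<ge>N. dist (F i) (F j) < e n"
    using assms unfolding Cauchy_def by blast
  then obtain N where N: "\<And>n i j. i \<ge> N n \<Longrightarrow> j \<ge> N n \<Longrightarrow> dist (F i) (F j) < e n"
    by metis
  \<comment> \<open>The summand \<open>N n\<close> puts \<open>r n\<close> beyond the threshold for
    the tolerance \<open>e n\<close>, and the summand \<open>n\<close> makes \<open>r\<close>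
    strictly increasing.\<close>
  define r where "r n = n + (\<Sum>k\<le>n. N k)" for n
  have "strict_mono r"
    by (rule strict_monoI_Suc) (simp add: r_def)
  moreover have "r n \<ge> N n" for n
    using member_le_sum[of n "{..n}" N] by (simp add: r_def)
  moreover have "r (Suc n) \<ge> r n" for n
    by (simp add: r_def)
  ultimately show ?thesis
    using that N by (meson order_trans)
qed

text \<open>The terms of a convergent series are eventually below 1, which here bounds
  \<open>norm (d n)\<close> by \<open>(1 / 2) ^ n\<close>.\<close>

lemma summable_norm_of_weighted_squares:
  fixes d :: "nat \<Rightarrow> 'b::real_normed_vector"
  assumes "summable (\<lambda>n. 4 ^ n * (norm (d n))\<^sup>2)"
  shows "summable (\<lambda>n. norm (d n))"
proof (rule summable_comparison_test_ev)
  have "(\<lambda>n. 4 ^ n * (norm (d n))\<^sup>2) \<longlonglongrightarrow> 0"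
    using assms by (rule summable_LIMSEQ_zero)
  hence "\<forall>\<^sub>F n in sequentially. 4 ^ n * (norm (d n))\<^sup>2 < 1"
    by (rule order_tendstoD) simp
  thus "\<forall>\<^sub>F n in sequentially. norm (norm (d n)) \<le> (1 / 2) ^ n"
  proof eventually_elim
    case (elim n)
    have "(2 ^ n * norm (d n))\<^sup>2 = 4 ^ n * (norm (d n))\<^sup>2"
      by (simp add: power_mult_distrib flip: power_mult) (simp add: power_mult mult.commute[of _ 2])
    hence "(2 ^ n * norm (d n))\<^sup>2 < 1\<^sup>2" using elim by simp
    hence "2 ^ n * norm (d n) < 1"
      by (rule power_less_imp_less_base) simp
    thus ?case by (simp add: field_simps)
  qed
  show "summable (\<lambda>n. (1 / 2) ^ n :: real)"
    by (rule summable_geometric) simp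
qed

text \<open>The conclusion records almost everywhere convergence along a subsequence as well,
  because pointwise conditions pass to limits through it.\<close>

theorem L2_Riesz_Fischer:
  fixes F :: "nat \<Rightarrow> ('a::euclidean_space, 'b::{complex_inner, second_countable_topology, banach}) L2"
  assumes F: "Cauchy F"
  obtains f r where "f \<in> L2_fun" "strict_mono r" "F \<longlonglongrightarrow> abs_L2 f"
    "AE x in lborel. (\<lambda>n. rep_L2 (F (r n)) x) \<longlonglongrightarrow> f x"
proof -
  obtain r where r: "strict_mono r" and Fr: "\<And>n. dist (F (r (Suc n))) (F (r n)) < (1 / 4) ^ n"
    using fast_Cauchy_subseq[OF F, of "\<lambda>n. (1 / 4) ^ n"] by auto
  define g where "g n = rep_L2 (F (r n))" for n
  define d where "d n x = g (Suc n) x - g n x" for n x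
  define f where "f x = lim (\<lambda>n. g n x)" for x
  have g: "g n \<in> L2_fun" "abs_L2 (g n) = F (r n)" for n
    by (simp_all add: g_def rep_L2_fun)
  have [measurable]: "g n \<in> borel_measurable borel" for n
    by (rule L2_fun_measurable[OF g(1)])
  have [measurable]: "f \<in> borel_measurable borel" "d n \<in> borel_measurable borel" for n
    unfolding f_def[abs_def] d_def[abs_def] by measurable
  have gg: "(\<lambda>x. g n x - g m x) \<in> L2_fun"
    "(\<integral>\<^sup>+x. ennreal ((norm (g n x - g m x))\<^sup>2) \<partial>lborel) = ennreal ((dist (F (r n)) (F (r m)))\<^sup>2)" for n m
  proof -
    show *: "(\<lambda>x. g n x - g m x) \<in> L2_fun" by (rule L2_fun_diff[OF g(1) g(1)])
    have "abs_L2 (\<lambda>x. g n x - g m x) = F (r n) - F (r m)"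
      using abs_L2_diff[OF g(1) g(1)] by (simp add: g(2))
    thus "(\<integral>\<^sup>+x. ennreal ((norm (g n x - g m x))\<^sup>2) \<partial>lborel) = ennreal ((dist (F (r n)) (F (r m)))\<^sup>2)"
      by (simp add: nn_integral_norm_L2[OF *] dist_norm)
  qed
  \<comment> \<open>The weight \<open>4 ^ n\<close> is affordable since the squared increments have
    integrals below \<open>(1 / 16) ^ n\<close>. Finiteness of the integrated series makes the
    increments absolutely summable almost everywhere.\<close>
  have "(\<integral>\<^sup>+x. (\<Sum>n. ennreal (4 ^ n * (norm (d n x))\<^sup>2)) \<partial>lborel) =
      (\<Sum>n. \<integral>\<^sup>+x. ennreal (4 ^ n * (norm (d n x))\<^sup>2) \<partial>lborel)"
    by (rule nn_integral_suminf) measurable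
  also have "\<dots> = (\<Sum>n. ennreal (4 ^ n * (dist (F (r (Suc n))) (F (r n)))\<^sup>2))"
    by (simp add: ennreal_mult nn_integral_cmult gg(2) d_def)
  also have "\<dots> \<le> (\<Sum>n. ennreal ((1 / 4) ^ n))"
  proof (intro suminf_le ennreal_leI)
    fix n
    have "(dist (F (r (Suc n))) (F (r n)))\<^sup>2 \<le> ((1 / 4) ^ n)\<^sup>2"
      using Fr[of n] by (intro power_mono) auto
    hence "4 ^ n * (dist (F (r (Suc n))) (F (r n)))\<^sup>2 \<le> 4 ^ n * ((1 / 4) ^ n)\<^sup>2"
      by (intro mult_left_mono) auto
    also have "\<dots> = (1 / 4) ^ n"
      by (simp add: power2_eq_square power_one_over)
    finally show "4 ^ n * (dist (F (r (Suc n))) (F (r n)))\<^sup>2 \<le> (1 / 4) ^ n" .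
  qed auto
  also have "\<dots> = ennreal (\<Sum>n. (1 / 4) ^ n)"
    by (intro suminf_ennreal_eq summable_sums summable_geometric) auto
  also have "\<dots> < \<infinity>" by simp
  finally have fin: "(\<integral>\<^sup>+x. (\<Sum>n. ennreal (4 ^ n * (norm (d n x))\<^sup>2)) \<partial>lborel) < \<infinity>" .
  have "AE x in lborel. (\<Sum>n. ennreal (4 ^ n * (norm (d n x))\<^sup>2)) \<noteq> \<infinity>"
    by (rule nn_integral_PInf_AE) (measurable, use fin in auto)
  hence lim: "AE x in lborel. (\<lambda>n. g n x) \<longlonglongrightarrow> f x"
  proof eventually_elim
    case (elim x)
    have "summable (\<lambda>n. 4 ^ n * (norm (d n x))\<^sup>2)"
      using elim by (intro summable_suminf_not_top) auto
    hence "summable (\<lambda>n. norm (d n x))"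
      by (rule summable_norm_of_weighted_squares)
    hence "summable (\<lambda>n. d n x)"
      by (rule summable_norm_cancel)
    hence "convergent (\<lambda>n. \<Sum>k<n. d k x)"
      by (simp add: summable_iff_convergent)
    moreover have "(\<Sum>k<n. d k x) = g n x - g 0 x" for n
      unfolding d_def by (rule sum_lessThan_telescope)
    ultimately have "convergent (\<lambda>n. g n x - g 0 x)" by simp
    hence "convergent (\<lambda>n. (g n x - g 0 x) + g 0 x)"
      by (intro convergent_add convergent_const)
    thus ?case
      by (simp add: f_def convergent_LIMSEQ_iff)
  qed
  \<comment> \<open>Fatou's lemma in the index \<open>m\<close> carries the bound on the distances
    over to the pointwise limit \<open>f\<close>.\<close>
  have close: "(\<integral>\<^sup>+x. ennreal ((norm (f x - g n x))\<^sup>2) \<partial>lborel) \<le> ennreal (e\<^sup>2)"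
    if e: "\<And>m. m \<ge> n \<Longrightarrow> dist (F (r m)) (F (r n)) \<le> e" for n e
  proof -
    have "(\<integral>\<^sup>+x. ennreal ((norm (f x - g n x))\<^sup>2) \<partial>lborel) =
        (\<integral>\<^sup>+x. liminf (\<lambda>m. ennreal ((norm (g m x - g n x))\<^sup>2)) \<partial>lborel)"
    proof (rule nn_integral_cong_AE)
      show "AE x in lborel. ennreal ((norm (f x - g n x))\<^sup>2) =
          liminf (\<lambda>m. ennreal ((norm (g m x - g n x))\<^sup>2))"
        using lim
      proof eventually_elim
        case (elim x)
        hence "(\<lambda>m. ennreal ((norm (g m x - g n x))\<^sup>2)) \<longlonglongrightarrow> ennreal ((norm (f x - g n x))\<^sup>2)"
          by (intro tendsto_intros tendsto_ennrealI)
        thus ?case by (intro lim_imp_Liminf[symmetric]) auto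
      qed
    qed
    also have "\<dots> \<le> liminf (\<lambda>m. \<integral>\<^sup>+x. ennreal ((norm (g m x - g n x))\<^sup>2) \<partial>lborel)"
      by (rule nn_integral_liminf) measurable
    also have "\<dots> \<le> liminf (\<lambda>m. ennreal (e\<^sup>2))"
      unfolding gg(2)
      by (intro Liminf_mono eventually_sequentiallyI[of n] ennreal_leI power_mono e) auto
    also have "\<dots> = ennreal (e\<^sup>2)" by (simp add: Liminf_const)
    finally show ?thesis .
  qed
  have "\<exists>M. \<forall>m\<ge>M. \<forall>n\<ge>M. dist (F (r m)) (F (r n)) < e" if "e > 0" for e
    using Cauchy_subseq_Cauchy[OF F r] that unfolding Cauchy_def o_def by blast
  hence C: "\<exists>M. \<forall>m\<ge>M. \<forall>n\<ge>M. dist (F (r m)) (F (r n)) \<le> e" if "e > 0" for e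
    using that by (meson less_imp_le)
  have fg: "(\<lambda>x. f x - g n x) \<in> L2_fun" for n
  proof -
    \<comment> \<open>Finiteness comes from a single index \<open>M\<close> at the arbitrary
      tolerance 1; adding the square-integrable difference of \<open>g M\<close> and
      \<open>g n\<close> then reaches every index \<open>n\<close>.\<close>
    obtain M where M: "\<forall>m\<ge>M. \<forall>n\<ge>M. dist (F (r m)) (F (r n)) \<le> 1"
      using C[of 1] by auto
    have "(\<lambda>x. f x - g M x) \<in> L2_fun"
      by (rule L2_funI) (use close[of M 1] M in \<open>auto intro: le_less_trans\<close>)
    from L2_fun_add[OF this gg(1)[of M n]] show ?thesis by simp
  qed
  have f: "f \<in> L2_fun"
    using L2_fun_add[OF fg[of 0] g(1)[of 0]] by simp
  have "(\<lambda>n. F (r n)) \<longlonglongrightarrow> abs_L2 f"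
  proof (rule metric_LIMSEQ_I)
    fix e :: real assume "e > 0"
    then obtain M where M: "\<forall>m\<ge>M. \<forall>n\<ge>M. dist (F (r m)) (F (r n)) \<le> e / 2"
      using C[of "e / 2"] by auto
    have "dist (F (r n)) (abs_L2 f) < e" if "n \<ge> M" for n
    proof -
      have "ennreal ((norm (abs_L2 (\<lambda>x. f x - g n x)))\<^sup>2) \<le> ennreal ((e / 2)\<^sup>2)"
        unfolding nn_integral_norm_L2[OF fg, symmetric] by (rule close) (use M that in auto)
      hence "norm (abs_L2 (\<lambda>x. f x - g n x)) \<le> e / 2"
        using \<open>e > 0\<close> by (simp add: ennreal_le_iff power2_le_iff_abs_le)
      moreover have "abs_L2 (\<lambda>x. f x - g n x) = abs_L2 f - F (r n)"
        using abs_L2_diff[OF f g(1)] by (simp add: g(2))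
      ultimately show ?thesis using \<open>e > 0\<close> by (simp add: dist_norm norm_minus_commute)
    qed
    thus "\<exists>M. \<forall>n\<ge>M. dist (F (r n)) (abs_L2 f) < e" by blast
  qed
  hence "F \<longlonglongrightarrow> abs_L2 f"
    using Cauchy_converges_subseq[OF F r] by (simp add: o_def)
  with that f r lim show ?thesis by (simp add: g_def)
qed

lemma complete_L2:
  "complete (UNIV :: ('a::euclidean_space, 'b::{complex_inner, second_countable_topology, banach}) L2 set)"
  unfolding complete_def by (blast elim: L2_Riesz_Fischer)

text \<open>A limit in \<open>L2\<close> is also an almost everywhere limit of a subsequence, and
  the countably many exceptional null sets still form a null set.\<close>

lemma closed_L2_AE:
  fixes C :: "'a::euclidean_space \<Rightarrow> 'b::{complex_inner, second_countable_topology, banach} set"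
  assumes "\<And>x. closed (C x)"
  shows "closed {F. AE x in lborel. rep_L2 F x \<in> C x}"
  unfolding closed_sequential_limits
proof safe
  fix F :: "nat \<Rightarrow> ('a, 'b) L2" and G
  assume F: "\<forall>n. F n \<in> {F. AE x in lborel. rep_L2 F x \<in> C x}" and lim: "F \<longlonglongrightarrow> G"
  obtain f r where f: "f \<in> L2_fun" "F \<longlonglongrightarrow> abs_L2 f"
    and AE: "AE x in lborel. (\<lambda>n. rep_L2 (F (r n)) x) \<longlonglongrightarrow> f x"
    by (rule L2_Riesz_Fischer[OF LIMSEQ_imp_Cauchy[OF lim]])
  have "G = abs_L2 f" using lim f(2) by (rule LIMSEQ_unique)
  hence "AE x in lborel. rep_L2 G x = f x" using rep_abs_L2_AE[OF f(1)] by simp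
  moreover have "AE x in lborel. \<forall>n. rep_L2 (F (r n)) x \<in> C x"
    using F by (auto simp: AE_all_countable)
  ultimately show "AE x in lborel. rep_L2 G x \<in> C x"
    using AE
  proof eventually_elim
    case (elim x)
    thus ?case using closed_sequentially[OF assms] by metis
  qed
qed
section \<open>Orthogonal projections\<close>

lemma csubspace_diff: "csubspace V \<Longrightarrow> x \<in> V \<Longrightarrow> y \<in> V \<Longrightarrow> x - y \<in> V"
  for x y :: "'a::complex_inner"
proof -
  assume V: "csubspace V" "x \<in> V" "y \<in> V"
  have "- y = (- 1) *\<^sub>C y"
    using scaleR_scaleC[of "- 1" y] by simp
  thus "x - y \<in> V"
    using V unfolding csubspace_def diff_conv_add_uminus by metis
qed

lemma csubspace_subspace: "csubspace V \<Longrightarrow> subspace (V :: 'a::complex_inner set)"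
  by (auto simp: csubspace_def subspace_def scaleR_scaleC)

text \<open>By the parallelogram law a sequence minimizing the distance to \<open>x\<close> is
  Cauchy, so completeness suffices in place of compactness.\<close>

lemma closest_point_exists_complete:
  fixes V :: "'a::real_inner set"
  assumes V: "complete V" "subspace V"
  obtains p where "p \<in> V" "\<And>v. v \<in> V \<Longrightarrow> dist x p \<le> dist x v"
proof -
  define d where "d = infdist x V"
  have ne: "V \<noteq> {}" using V(2) subspace_0 by blast
  have d0: "0 \<le> d" by (simp add: d_def infdist_nonneg)
  have dle: "d \<le> dist x v" if "v \<in> V" for v
    using that by (simp add: d_def infdist_le)
  have "\<exists>v\<in>V. dist x v < d + 1 / real (Suc n)" for n
    using cINF_less_iff[OF ne, of "dist x" "d + 1 / real (Suc n)"] ne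
    by (auto simp: d_def infdist_notempty intro: bdd_belowI[of _ 0])
  then obtain v where v: "\<And>n. v n \<in> V" "\<And>n. dist x (v n) < d + 1 / real (Suc n)" by metis
  \<comment> \<open>The parallelogram law is applied to the differences of \<open>x\<close> with
    \<open>v m\<close> and \<open>v n\<close>; their midpoint lies in \<open>V\<close>, hence at
    distance at least \<open>d\<close> from \<open>x\<close>.\<close>
  have par: "(dist (v m) (v n))\<^sup>2 \<le> 2 * (dist x (v m))\<^sup>2 + 2 * (dist x (v n))\<^sup>2 - 4 * d\<^sup>2" for m n
  proof -
    let ?w = "(1 / 2) *\<^sub>R (v m + v n)"
    have "?w \<in> V" using v V(2) by (intro subspace_scale subspace_add)
    hence "d\<^sup>2 \<le> (dist x ?w)\<^sup>2" using dle d0 by (intro power_mono) auto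
    moreover have "(dist (v m) (v n))\<^sup>2 + 4 * (dist x ?w)\<^sup>2 = 2 * (dist x (v m))\<^sup>2 + 2 * (dist x (v n))\<^sup>2"
      by (simp add: dist_norm power2_norm_eq_inner inner_simps inner_commute algebra_simps)
    ultimately show ?thesis by linarith
  qed
  have lim: "(\<lambda>n. dist x (v n)) \<longlonglongrightarrow> d"
  proof (rule tendsto_sandwich[of "\<lambda>_. d" _ _ "\<lambda>n. d + 1 / real (Suc n)"])
    show "(\<lambda>n. d + 1 / real (Suc n)) \<longlonglongrightarrow> d"
      using tendsto_add[OF tendsto_const LIMSEQ_inverse_real_of_nat] by (simp add: divide_inverse)
  qed (use v(1) dle less_imp_le[OF v(2)] in \<open>auto simp del: of_nat_Suc\<close>)
  have "Cauchy v"
    unfolding Cauchy_altdef2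
  proof (intro allI impI)
    fix e :: real assume e: "e > 0"
    have "(\<lambda>n. 4 * (dist x (v n))\<^sup>2) \<longlonglongrightarrow> 4 * d\<^sup>2" by (intro tendsto_intros lim)
    hence "\<forall>\<^sub>F n in sequentially. 4 * (dist x (v n))\<^sup>2 < 4 * d\<^sup>2 + e\<^sup>2"
      by (rule order_tendstoD) (use e in simp)
    then obtain N where N: "\<And>n. n \<ge> N \<Longrightarrow> 4 * (dist x (v n))\<^sup>2 < 4 * d\<^sup>2 + e\<^sup>2"
      by (auto simp: eventually_sequentially)
    have "dist (v n) (v N) < e" if "n \<ge> N" for n
    proof -
      have "(dist (v n) (v N))\<^sup>2 < e\<^sup>2"
        using par[of n N] N[OF that] N[of N] by linarith
      thus ?thesis using e by (simp add: power_less_imp_less_base)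
    qed
    thus "\<exists>N. \<forall>n\<ge>N. dist (v n) (v N) < e" by blast
  qed
  then obtain p where p: "p \<in> V" "v \<longlonglongrightarrow> p"
    using V(1) v(1) unfolding complete_def by blast
  hence "dist x p = d"
    by (intro LIMSEQ_unique[OF _ lim] tendsto_intros)
  with that p(1) dle show ?thesis by simp
qed

text \<open>The closest point satisfies a variational inequality. Testing it with \<open>v\<close>
  and \<open>- v\<close> gives orthogonality for the real inner product, and testing with
  \<open>\<i> *\<^sub>C v\<close> adds the imaginary part.\<close>

lemma orthogonal_projection_exists:
  fixes V :: "'a::complex_inner set"
  assumes V: "complete V" "csubspace V"
  obtains p where "p \<in> V" "\<And>v. v \<in> V \<Longrightarrow> cinner (x - p) v = 0"
proof -
  obtain p where p: "p \<in> V" "\<And>v. v \<in> V \<Longrightarrow> dist x p \<le> dist x v"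
    using closest_point_exists_complete[OF V(1) csubspace_subspace[OF V(2)]] by blast
  have le: "inner (x - p) v \<le> 0" if v: "v \<in> V" for v
  proof -
    have "p + v \<in> V" using V p v by (simp add: csubspace_def)
    hence "inner (x - p) (p + v - p) \<le> 0"
      using V p by (intro any_closest_point_dot[of V])
        (auto simp: complete_imp_closed csubspace_subspace subspace_imp_convex)
    thus ?thesis by simp
  qed
  have eq: "inner (x - p) v = 0" if "v \<in> V" for v
    using le[OF that] le[of "- v"] subspace_neg[OF csubspace_subspace[OF V(2)] that] by simp
  have "cinner (x - p) v = 0" if v: "v \<in> V" for v
  proof -
    have "\<i> *\<^sub>C v \<in> V" using V(2) v by (simp add: csubspace_def)
    from eq[OF v] eq[OF this] show ?thesis
      by (simp add: inner_eq_Re_cinner cinner_scaleC_right complex_eq_iff)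
  qed
  with that p(1) show ?thesis by blast
qed

lemma orthogonal_vector_exists:
  fixes V H :: "'a::complex_inner set"
  assumes "complete H" "csubspace H" "closed V" "csubspace V" "V \<subseteq> H" "V \<noteq> H"
  obtains x where "x \<in> H" "x \<noteq> 0" "\<And>v. v \<in> V \<Longrightarrow> cinner x v = 0"
proof -
  obtain y where y: "y \<in> H" "y \<notin> V" using assms by blast
  have "complete V"
    using complete_Int_closed[OF assms(1,3)] assms(5) by (simp add: Int_absorb1)
  then obtain p where p: "p \<in> V" "\<And>v. v \<in> V \<Longrightarrow> cinner (y - p) v = 0"
    using orthogonal_projection_exists[OF _ assms(4)] by metis
  show ?thesis
    by (rule that[OF _ _ p(2)]) (use p(1) y assms csubspace_diff[of H y p] in auto)
qed

section \<open>The representation on all of \<open>L\<^sup>2\<close>\<close>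

lemma bounded_bilinear_cliff_mult: "bounded_bilinear ((*) :: cliff2 \<Rightarrow> cliff2 \<Rightarrow> cliff2)"
  unfolding bilinear_conv_bounded_bilinear[symmetric] bilinear_def
  by (auto intro!: linearI simp: algebra_simps scaleR_scaleC scaleC_mult_cliff2)

lemmas tendsto_cliff_mult = bounded_bilinear.tendsto[OF bounded_bilinear_cliff_mult]

lemma bounded_bilinear_scaleC:
  "bounded_bilinear ((*\<^sub>C) :: complex \<Rightarrow> cliff2 \<Rightarrow> cliff2)"
  unfolding bilinear_conv_bounded_bilinear[symmetric] bilinear_def
  by (auto intro!: linearI simp: scaleC_add_left scaleC_add_right scaleR_scaleC scaleC_scaleC
      scaleR_conv_of_real mult.commute)

lemmas tendsto_scaleC = bounded_bilinear.tendsto[OF bounded_bilinear_scaleC]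

lemma cinner_spin_mult: "cinner (spin \<theta> * x) (spin \<theta> * y) = cinner x y"
proof -
  have *: "cinner (Cliff (complex_of_real a) 0 0 (complex_of_real b) * x)
      (Cliff (complex_of_real a) 0 0 (complex_of_real b) * y) = complex_of_real (a * a + b * b) * cinner x y"
    for a b
    by (simp add: cinner_cliff2_def times_cliff2_def algebra_simps)
  show ?thesis
    unfolding spin_eq * by (simp flip: power2_eq_square)
qed

lemma spin_sim_cases:
  assumes "g \<in> carrier spin_sim"
  obtains r \<theta> b where "g = (r, spin \<theta>, b)" "r > 0"
  using assms by (auto simp: spin_sim_def Spin2_def)

lemma sim_fun_eq:
  "sim_fun (r, s, b) f y = cis (2 * pi * (b \<bullet> y)) *\<^sub>C r *\<^sub>R (s * f (sim_map r s y))"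
  by (simp add: sim_fun_def sim_map_def cis_conv_exp mult_ac)

lemma sim_map_measurable [measurable]: "sim_map r (spin \<theta>) \<in> borel \<rightarrow>\<^sub>M borel"
  by (intro borel_measurable_continuous_onI linear_continuous_on linear_sim_map
      linear_conv_bounded_linear[THEN iffD1])

lemma sim_fun_L2_fun:
  assumes "g \<in> carrier spin_sim" "f \<in> L2_fun"
  shows "sim_fun g f \<in> L2_fun"
  using sim_fun_L2_eq[OF assms(1) L2_eq_refl[OF assms(2)]] by (simp add: L2_eq_def)

section \<open>Homomorphism property, linearity and isometry of the operators\<close>

lemma sim_fun_mult:
  assumes "g \<in> carrier spin_sim" "h \<in> carrier spin_sim"
  shows "sim_fun (g \<otimes>\<^bsub>spin_sim\<^esub> h) f y = sim_fun g (sim_fun h f) y"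
proof -
  obtain r \<theta> b where g: "g = (r, spin \<theta>, b)" "r > 0" by (rule spin_sim_cases[OF assms(1)])
  obtain r' \<theta>' b' where h: "h = (r', spin \<theta>', b')" "r' > 0" by (rule spin_sim_cases[OF assms(2)])
  define b'' where "b'' = r *\<^sub>R cliff_unvec (spin \<theta> * cliff_vec b' * cliff_inv (spin \<theta>)) + b"
  have gh: "g \<otimes>\<^bsub>spin_sim\<^esub> h = (r * r', spin (\<theta> + \<theta>'), b'')"
    by (simp add: g h spin_sim_def spin_mult b''_def)
  have m: "sim_map (r * r') (spin (\<theta> + \<theta>')) y = sim_map r' (spin \<theta>') (sim_map r (spin \<theta>) y)"
    by (simp add: sim_map_spin vec_eq_iff forall_2 distrib_left cos_add sin_add) (simp add: algebra_simps)
  \<comment> \<open>A rotation is orthogonal, so moving it to the other side of the inner product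
    inverts it; this is why the characters multiply correctly.\<close>
  have b: "b'' \<bullet> y = b \<bullet> y + b' \<bullet> sim_map r (spin \<theta>) y"
    unfolding b''_def cliff_inv_spin spin_conj_vec cliff_unvec_vec
    by (simp add: sim_map_spin inner_vec_def sum_2) (simp add: algebra_simps)
  have c: "cis (2 * pi * (b'' \<bullet> y)) =
      cis (2 * pi * (b \<bullet> y)) * cis (2 * pi * (b' \<bullet> sim_map r (spin \<theta>) y))"
    by (simp add: b cis_mult distrib_left)
  show ?thesis
    unfolding gh sim_fun_eq m c
    by (simp add: g h sim_fun_eq spin_mult[symmetric] scaleR_scaleC scaleC_scaleC scaleC_mult_cliff2 mult_ac)
qed

lemma sim_fun_add: "sim_fun g (\<lambda>y. f y + f' y) y = sim_fun g f y + sim_fun g f' y"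
  by (cases g) (simp add: sim_fun_eq distrib_left scaleC_add_right scaleR_add_right)

lemma sim_fun_scaleC: "sim_fun g (\<lambda>y. c *\<^sub>C f y) y = c *\<^sub>C sim_fun g f y"
  by (cases g) (simp add: sim_fun_eq scaleC_mult_cliff2 scaleR_scaleC scaleC_scaleC mult_ac)

lemma sim_rep_add:
  assumes "g \<in> carrier spin_sim"
  shows "sim_rep g (F + F') = sim_rep g F + sim_rep g F'"
proof -
  obtain f f' where "f \<in> L2_fun" "F = abs_L2 f" "f' \<in> L2_fun" "F' = abs_L2 f'"
    by (metis L2_cases)
  thus ?thesis
    using assms by (simp add: abs_L2_add sim_rep_abs L2_fun_add sim_fun_L2_fun sim_fun_add[abs_def])
qed

lemma sim_rep_scaleC:
  assumes "g \<in> carrier spin_sim"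
  shows "sim_rep g (c *\<^sub>C F) = c *\<^sub>C sim_rep g F"
proof -
  obtain f where "f \<in> L2_fun" "F = abs_L2 f"
    by (metis L2_cases)
  thus ?thesis
    using assms by (simp add: abs_L2_scaleC sim_rep_abs L2_fun_scaleC sim_fun_L2_fun sim_fun_scaleC[abs_def])
qed

lemma sim_rep_mult:
  assumes "g \<in> carrier spin_sim" "h \<in> carrier spin_sim"
  shows "sim_rep (g \<otimes>\<^bsub>spin_sim\<^esub> h) F = sim_rep g (sim_rep h F)"
proof -
  obtain f where f: "f \<in> L2_fun" "F = abs_L2 f"
    by (metis L2_cases)
  have "g \<otimes>\<^bsub>spin_sim\<^esub> h \<in> carrier spin_sim"
    using assms group_spin_sim by (simp add: group.is_monoid monoid.m_closed)
  moreover have "sim_fun (g \<otimes>\<^bsub>spin_sim\<^esub> h) f = sim_fun g (sim_fun h f)"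
    by (rule ext) (rule sim_fun_mult[OF assms])
  ultimately show ?thesis
    using f assms by (simp add: sim_rep_abs sim_fun_L2_fun)
qed

lemma sim_rep_one: "sim_rep \<one>\<^bsub>spin_sim\<^esub> F = F"
proof -
  obtain f where f: "f \<in> L2_fun" "F = abs_L2 f"
    by (metis L2_cases)
  have "sim_map 1 1 y = y" for y
    using sim_map_spin[of 1 0 y] by (simp add: vec_eq_iff forall_2)
  moreover have "1 *\<^sub>C x = x" for x :: cliff2
    using scaleR_scaleC[of 1 x] by simp
  ultimately have "sim_fun \<one>\<^bsub>spin_sim\<^esub> f = f"
    by (simp add: spin_sim_def sim_fun_eq fun_eq_iff)
  moreover have "\<one>\<^bsub>spin_sim\<^esub> \<in> carrier spin_sim"
    using group_spin_sim by (simp add: group.is_monoid)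
  ultimately show ?thesis using f by (simp add: sim_rep_abs)
qed

text \<open>The factor \<open>r\<^sup>2\<close> is the Jacobian determinant of the similitude. It
  matches the square of the factor \<open>r\<close> in \<open>sim_fun\<close>, which makes the
  operators isometric.\<close>

lemma lborel_integral_sim_map:
  fixes \<phi> :: "real^2 \<Rightarrow> 'b::{banach, second_countable_topology}"
  assumes r: "r > 0" and [measurable]: "\<phi> \<in> borel_measurable borel"
  shows "(LINT y|lborel. r\<^sup>2 *\<^sub>R \<phi> (sim_map r (spin \<theta>) y)) = (LINT y|lborel. \<phi> y)"
  by (subst (2) lborel_sim_map[OF r, of \<theta>]) (simp add: integral_density integral_distr)

lemma cinner_sim_rep:
  assumes "g \<in> carrier spin_sim"
  shows "cinner (sim_rep g F) (sim_rep g F') = cinner F F'"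
proof -
  obtain r \<theta> b where g: "g = (r, spin \<theta>, b)" "r > 0" by (rule spin_sim_cases[OF assms(1)])
  obtain f f' where f: "f \<in> L2_fun" "F = abs_L2 f" "f' \<in> L2_fun" "F' = abs_L2 f'"
    by (metis L2_cases)
  hence [measurable]: "f \<in> borel_measurable borel" "f' \<in> borel_measurable borel"
    by (simp_all add: L2_fun_measurable)
  have "cinner (sim_fun g f y) (sim_fun g f' y) =
      r\<^sup>2 *\<^sub>R cinner (f (sim_map r (spin \<theta>) y)) (f' (sim_map r (spin \<theta>) y))" for y
  proof -
    have "cnj (cis t) * cis t = 1" for t by (simp add: cis_cnj cis_mult)
    thus ?thesis
      by (simp add: g sim_fun_eq cinner_scaleC_left cinner_scaleC_right scaleR_scaleC cinner_spin_mult
          scaleR_conv_of_real power2_eq_square mult_ac)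
  qed
  thus ?thesis
    using f assms lborel_integral_sim_map[OF g(2), of "\<lambda>y. cinner (f y) (f' y)" \<theta>]
    by (simp add: sim_rep_abs cinner_abs_L2 sim_fun_L2_fun)
qed

lemma norm_sim_rep:
  assumes "g \<in> carrier spin_sim"
  shows "norm (sim_rep g F) = norm F"
  using cinner_sim_rep[OF assms, of F F] unfolding norm_eq_sqrt_inner inner_eq_Re_cinner by simp

lemma sim_rep_diff:
  assumes "g \<in> carrier spin_sim"
  shows "sim_rep g (F - F') = sim_rep g F - sim_rep g F'"
  using sim_rep_add[OF assms, of "F - F'" F'] by (simp add: algebra_simps)

section \<open>Strong continuity\<close>

lemma norm_sim_map:
  assumes "r > 0"
  shows "norm (sim_map r (spin \<theta>) y) = r * norm y"
proof -
  have "(norm (sim_map r (spin \<theta>) y))\<^sup>2 =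
      r\<^sup>2 * (((cos (2 * \<theta>))\<^sup>2 + (sin (2 * \<theta>))\<^sup>2) * ((y $ 1)\<^sup>2 + (y $ 2)\<^sup>2))"
    by (simp only: power2_norm_eq_inner inner_vec_def sum_2 sim_map_spin vector_2 inner_real_def)
      (simp only: power2_eq_square algebra_simps)
  also have "\<dots> = (r * norm y)\<^sup>2"
    unfolding power_mult_distrib power2_norm_eq_inner inner_vec_def sum_2
    by (simp add: power2_eq_square)
  finally show ?thesis
    using assms by (simp add: power2_eq_iff_nonneg)
qed

text \<open>No choice of the angle is continuous on all of \<open>Spin2\<close>, so the similitude
  is written as a polynomial in the coordinates of \<open>s\<close>, where limits can be taken
  directly.\<close>

lemma sim_map_Spin2:
  assumes "s \<in> Spin2"
  shows "sim_map r s y =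
    (let c = Cliff 1 0 0 0 \<bullet> s; d = Cliff 0 0 0 1 \<bullet> s
     in vector [r * ((c\<^sup>2 - d\<^sup>2) * y $ 1 + 2 * d * c * y $ 2), r * ((c\<^sup>2 - d\<^sup>2) * y $ 2 - 2 * d * c * y $ 1)])"
proof -
  obtain \<theta> where s: "s = spin \<theta>" using assms by (auto simp: Spin2_def)
  have "Cliff 1 0 0 0 \<bullet> s = cos \<theta>" "Cliff 0 0 0 1 \<bullet> s = sin \<theta>"
    by (simp_all add: s spin_eq inner_cliff2_def cinner_cliff2_def)
  thus ?thesis
    by (simp add: s sim_map_spin cos_double sin_double Let_def)
qed

lemma sim_fun_tendsto:
  fixes f :: "real^2 \<Rightarrow> cliff2"
  assumes f: "continuous_on UNIV f" and g: "g \<in> carrier spin_sim"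
    and h: "\<And>n. h n \<in> carrier spin_sim" "h \<longlonglongrightarrow> g"
  shows "(\<lambda>n. sim_fun (h n) f y) \<longlonglongrightarrow> sim_fun g f y"
proof -
  define r s b where "r n = fst (h n)" and "s n = fst (snd (h n))" and "b n = snd (snd (h n))" for n
  obtain r' s' b' where g': "g = (r', s', b')" by (metis prod_cases3)
  have h': "h n = (r n, s n, b n)" for n by (simp add: r_def s_def b_def)
  have r: "r \<longlonglongrightarrow> r'" and s: "s \<longlonglongrightarrow> s'" and b: "b \<longlonglongrightarrow> b'"
    using tendsto_fst[OF h(2)] tendsto_fst[OF tendsto_snd[OF h(2)]] tendsto_snd[OF tendsto_snd[OF h(2)]]
    by (simp_all add: r_def[abs_def] s_def[abs_def] b_def[abs_def] g')
  have S: "s n \<in> Spin2" "s' \<in> Spin2" for n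
    using h(1)[of n] g by (simp_all add: h' g' spin_sim_def)
  have "(\<lambda>n. sim_map (r n) (s n) y) \<longlonglongrightarrow> sim_map r' s' y"
  proof (rule vec_tendstoI)
    fix i :: 2
    show "(\<lambda>n. sim_map (r n) (s n) y $ i) \<longlonglongrightarrow> sim_map r' s' y $ i"
      unfolding sim_map_Spin2[OF S(1)] sim_map_Spin2[OF S(2)] Let_def
      using exhaust_2[of i] by (elim disjE; simp only: vector_2; intro tendsto_intros r s)
  qed
  hence "(\<lambda>n. f (sim_map (r n) (s n) y)) \<longlonglongrightarrow> f (sim_map r' s' y)"
    by (intro continuous_on_tendsto_compose[OF f]) auto
  thus ?thesis
    unfolding h' g' sim_fun_eq cis_conv_exp
    by (intro tendsto_scaleC tendsto_scaleR tendsto_cliff_mult tendsto_intros r s b)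
qed

text \<open>Pointwise convergence is upgraded by dominated convergence: near \<open>g\<close> the
  dilation factors stay away from 0 and infinity, so the transformed functions are uniformly bounded
  and live on one common ball.\<close>

lemma continuous_on_sim_rep_cont_fun:
  fixes f :: "real^2 \<Rightarrow> cliff2"
  assumes f: "continuous_on UNIV f" "f \<in> L2_fun"
    and supp: "\<And>y. norm y > R \<Longrightarrow> f y = 0" and B: "\<And>y. norm (f y) \<le> B"
  shows "continuous_on (carrier spin_sim) (\<lambda>g. sim_rep g (abs_L2 f))"
  unfolding continuous_on_sequentially
proof (intro ballI allI impI, elim conjE)
  fix h and g assume g: "g \<in> carrier spin_sim" and hc: "\<forall>n. h n \<in> carrier spin_sim" and lim: "h \<longlonglongrightarrow> g"
  have h: "h n \<in> carrier spin_sim" for n using hc by blast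
  obtain r' \<theta>' b' where g': "g = (r', spin \<theta>', b')" and r': "r' > 0" by (rule spin_sim_cases[OF g])
  have "(\<lambda>n. fst (h n)) \<longlonglongrightarrow> r'"
    using tendsto_fst[OF lim] by (simp add: g')
  hence "\<forall>\<^sub>F n in sequentially. fst (h n) > r' / 2 \<and> fst (h n) < 2 * r'"
    by (intro eventually_conj order_tendstoD) (use r' in auto)
  then obtain N where N: "\<And>n. n \<ge> N \<Longrightarrow> fst (h n) > r' / 2 \<and> fst (h n) < 2 * r'"
    by (auto simp: eventually_sequentially)
  have B0: "B \<ge> 0" using B[of 0] norm_ge_zero order_trans by blast
  \<comment> \<open>Dilation by at least \<open>r' / 2\<close> moves points of norm above
    \<open>2 * R / r'\<close> out of the support, and the prefactor \<open>r\<close> of the action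
    is at most \<open>2 * r'\<close>.\<close>
  have bound: "norm (sim_fun k f y) \<le> 2 * r' * B * indicator (cball 0 (2 * R / r')) y"
    if k: "k \<in> carrier spin_sim" "fst k > r' / 2" "fst k < 2 * r'" for k y
  proof -
    obtain r \<theta> b where k': "k = (r, spin \<theta>, b)" "r > 0" by (rule spin_sim_cases[OF k(1)])
    have n: "norm (sim_fun k f y) = r * norm (f (sim_map r (spin \<theta>) y))"
      using k' by (simp add: sim_fun_eq norm_spin_mult)
    show ?thesis
    proof (cases "norm y \<le> 2 * R / r'")
      case True
      have "r * norm (f (sim_map r (spin \<theta>) y)) \<le> 2 * r' * B"
        using k k' r' by (intro mult_mono B) auto
      thus ?thesis using True n by simp
    next
      case False
      hence "R < r' / 2 * norm y" using r' by (simp add: field_simps)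
      also have "\<dots> \<le> r * norm y" using k k' by (intro mult_right_mono) auto
      finally have "f (sim_map r (spin \<theta>) y) = 0"
        using k' by (intro supp) (simp add: norm_sim_map)
      thus ?thesis using n False by simp
    qed
  qed
  define D where "D n y = sim_fun (h (n + N)) f y - sim_fun g f y" for n y
  have D: "D n \<in> L2_fun" "abs_L2 (D n) = sim_rep (h (n + N)) (abs_L2 f) - sim_rep g (abs_L2 f)" for n
    using f(2) g h sim_fun_L2_fun[OF g f(2)] sim_fun_L2_fun[OF h f(2)]
    by (simp_all add: D_def[abs_def] sim_rep_abs abs_L2_diff L2_fun_diff)
  have "(\<lambda>n. LINT y|lborel. (norm (D n y))\<^sup>2) \<longlonglongrightarrow> (LINT (y :: real^2)|lborel. 0 :: real)"
  proof (rule integral_dominated_convergence)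
    let ?C = "cball 0 (2 * R / r') :: (real^2) set"
    show "integrable lborel (\<lambda>y. (4 * r' * B)\<^sup>2 * indicator ?C y :: real)"
      by (intro integrable_mult_right integrable_real_indicator)
        (use emeasure_bounded_finite[OF bounded_cball] in auto)
    show "AE y in lborel. norm ((norm (D n y))\<^sup>2) \<le> (4 * r' * B)\<^sup>2 * indicator ?C y" for n
    proof (rule AE_I2)
      fix y
      have "norm (D n y) \<le> norm (sim_fun (h (n + N)) f y) + norm (sim_fun g f y)"
        unfolding D_def by (rule norm_triangle_ineq4)
      also have "\<dots> \<le> 2 * r' * B * indicator ?C y + 2 * r' * B * indicator ?C y"
        using N[of "n + N"] r' g' by (intro add_mono bound g h) auto
      also have "\<dots> = 4 * r' * B * indicator ?C y" by simp
      finally have "(norm (D n y))\<^sup>2 \<le> (4 * r' * B * indicator ?C y)\<^sup>2"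
        by (intro power_mono) auto
      thus "norm ((norm (D n y))\<^sup>2) \<le> (4 * r' * B)\<^sup>2 * indicator ?C y"
        by (auto simp: indicator_def split: if_splits)
    qed
    show "AE y in lborel. (\<lambda>n. (norm (D n y))\<^sup>2) \<longlonglongrightarrow> 0"
    proof (rule AE_I2)
      fix y
      have "(\<lambda>n. D n y) \<longlonglongrightarrow> sim_fun g f y - sim_fun g f y"
        unfolding D_def
        by (intro tendsto_diff tendsto_const sim_fun_tendsto[OF f(1) g] h LIMSEQ_ignore_initial_segment lim)
      hence "(\<lambda>n. (norm (D n y))\<^sup>2) \<longlonglongrightarrow> (norm (sim_fun g f y - sim_fun g f y))\<^sup>2"
        by (intro tendsto_intros)
      thus "(\<lambda>n. (norm (D n y))\<^sup>2) \<longlonglongrightarrow> 0" by simp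
    qed
    show "(\<lambda>y. (norm (D n y))\<^sup>2) \<in> borel_measurable lborel" for n
      using L2_fun_measurable[OF D(1)] by simp
  qed simp
  hence "(\<lambda>n. (norm (sim_rep (h (n + N)) (abs_L2 f) - sim_rep g (abs_L2 f)))\<^sup>2) \<longlonglongrightarrow> 0"
    by (simp add: norm_abs_L2[OF D(1), symmetric] D(2))
  hence "(\<lambda>n. sqrt ((norm (sim_rep (h (n + N)) (abs_L2 f) - sim_rep g (abs_L2 f)))\<^sup>2)) \<longlonglongrightarrow> sqrt 0"
    by (rule tendsto_real_sqrt)
  hence "(\<lambda>n. norm (sim_rep (h (n + N)) (abs_L2 f) - sim_rep g (abs_L2 f))) \<longlonglongrightarrow> 0"
    by simp
  hence "(\<lambda>n. sim_rep (h (n + N)) (abs_L2 f)) \<longlonglongrightarrow> sim_rep g (abs_L2 f)"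
    by (rule LIM_zero_cancel[OF tendsto_norm_zero_cancel])
  thus "((\<lambda>g. sim_rep g (abs_L2 f)) \<circ> h) \<longlonglongrightarrow> sim_rep g (abs_L2 f)"
    unfolding o_def by (rule LIMSEQ_offset)
qed

text \<open>Since the operators are isometric, the vectors with continuous orbit maps form a closed
  subspace; a vector orthogonal to the compactly supported continuous functions
  \<open>y \<mapsto> exp (i b \<bullet> y) max 0 (R - |y|) x\<close> has a vanishing Fourier transform.\<close>

lemma continuous_on_sim_rep: "continuous_on (carrier spin_sim) (\<lambda>g. sim_rep g F)"
proof -
  define V where "V = {F. continuous_on (carrier spin_sim) (\<lambda>g. sim_rep g F)}"
  have V: "csubspace V"
    unfolding csubspace_def
  proof (intro conjI ballI allI)
    have "sim_rep g 0 = 0" if "g \<in> carrier spin_sim" for g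
      using sim_rep_diff[OF that, of 0 0] by simp
    thus "0 \<in> V"
      by (simp add: V_def cong: continuous_on_cong_simp)
  next
    fix F F' assume "F \<in> V" "F' \<in> V"
    hence "continuous_on (carrier spin_sim) (\<lambda>g. sim_rep g F + sim_rep g F')"
      by (intro continuous_on_add) (simp_all add: V_def)
    thus "F + F' \<in> V"
      by (simp add: V_def sim_rep_add cong: continuous_on_cong_simp)
  next
    fix c F assume "F \<in> V"
    hence "continuous_on (carrier spin_sim) (\<lambda>g. c *\<^sub>C sim_rep g F)"
      by (intro bounded_linear.continuous_on[OF bounded_linear_scaleC]) (simp add: V_def)
    thus "c *\<^sub>C F \<in> V"
      by (simp add: V_def sim_rep_scaleC cong: continuous_on_cong_simp)
  qed
  have closed: "closed V"
    unfolding closed_sequential_limits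
  proof safe
    fix X F assume X: "\<forall>n. X n \<in> V" and lim: "X \<longlonglongrightarrow> F"
    \<comment> \<open>All operators are isometries, so convergence of the vectors is uniform over
      the whole group.\<close>
    have "uniform_limit (carrier spin_sim) (\<lambda>n g. sim_rep g (X n)) (\<lambda>g. sim_rep g F) sequentially"
      unfolding uniform_limit_iff
    proof safe
      fix e :: real assume "e > 0"
      with lim have "\<forall>\<^sub>F n in sequentially. dist (X n) F < e" by (rule tendstoD)
      thus "\<forall>\<^sub>F n in sequentially. \<forall>g\<in>carrier spin_sim. dist (sim_rep g (X n)) (sim_rep g F) < e"
        by eventually_elim (simp add: dist_norm norm_sim_rep flip: sim_rep_diff)
    qed
    thus "F \<in> V"
      unfolding V_def mem_Collect_eq
      by (rule uniform_limit_theorem[rotated]) (use X in \<open>auto simp: V_def\<close>)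
  qed
  have "V = UNIV"
  proof (rule ccontr)
    assume ne: "V \<noteq> UNIV"
    have "csubspace (UNIV :: (real^2, cliff2) L2 set)" by (simp add: csubspace_def)
    then obtain G where G: "G \<noteq> 0" "\<And>F. F \<in> V \<Longrightarrow> cinner G F = 0"
      using orthogonal_vector_exists[OF complete_L2 _ closed V subset_UNIV ne] by metis
    obtain k where k: "k \<in> L2_fun" "G = abs_L2 k" by (metis L2_cases)
    have [measurable]: "k \<in> borel_measurable borel" by (rule L2_fun_measurable[OF k(1)])
    have AE: "AE y in lborel. complex_of_real (max 0 (R - norm y)) * cinner (k y) x = 0" for R x
    proof (rule fourier_null_AE_0)
      define f where "f b y = cis (b \<bullet> y) *\<^sub>C max 0 (R - norm y) *\<^sub>R x" for b y :: "real^2"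
      have nf: "norm (f b y) = max 0 (R - norm y) * norm x" for b y
        by (simp add: f_def)
      have cont: "continuous_on UNIV (f b)" for b
        unfolding f_def cis_conv_exp
        by (intro bounded_bilinear.continuous_on[OF bounded_bilinear_scaleC] continuous_intros)
      have "f b \<in> L2_fun" for b
        unfolding L2_fun_def
      proof safe
        have [measurable]: "f b \<in> borel_measurable borel"
          by (rule borel_measurable_continuous_onI[OF cont])
        show "f b \<in> borel_measurable lborel" by simp
        show "integrable lborel (\<lambda>y. (norm (f b y))\<^sup>2)"
        proof (rule Bochner_Integration.integrable_bound)
          show "integrable lborel (\<lambda>y. (R * norm x)\<^sup>2 * indicator (cball 0 R :: (real^2) set) y :: real)"
            by (intro integrable_mult_right integrable_real_indicator)
              (use emeasure_bounded_finite[OF bounded_cball] in auto)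
          show "AE y in lborel. norm ((norm (f b y))\<^sup>2) \<le>
              norm ((R * norm x)\<^sup>2 * indicator (cball 0 R :: (real^2) set) y :: real)"
            by (auto simp: nf indicator_def intro!: power_mono mult_right_mono)
        qed measurable
      qed
      note fL = this
      have bound: "norm (f b y) \<le> max 0 R * norm x" for b y
        unfolding nf by (intro mult_right_mono max.mono) auto
      have "abs_L2 (f b) \<in> V" for b
        unfolding V_def mem_Collect_eq
        by (rule continuous_on_sim_rep_cont_fun[OF cont fL _ bound, of R]) (simp add: f_def)
      from G(2)[OF this] have "(LINT y|lborel. cinner (k y) (f b y)) = 0" for b
        using k fL by (simp add: cinner_abs_L2)
      moreover have "cinner (k y) (f b y) =
          cis (b \<bullet> y) * (complex_of_real (max 0 (R - norm y)) * cinner (k y) x)" for b y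
        by (simp add: f_def scaleR_scaleC cinner_scaleC_right)
      moreover have "f 0 y = complex_of_real (max 0 (R - norm y)) *\<^sub>C x" for y
        by (simp add: f_def scaleR_scaleC scaleC_scaleC)
      ultimately show "(\<lambda>y. complex_of_real (max 0 (R - norm y)) * cinner (k y) x) \<in> fourier_null"
        using integrable_cinner[OF k(1) fL[of 0]] by (simp add: fourier_null_def cinner_scaleC_right)
    qed
    \<comment> \<open>Countably many radii and a finite real basis leave a single null set, outside
      of which every coordinate of \<open>k y\<close> vanishes.\<close>
    have "AE y in lborel. \<forall>n. \<forall>x\<in>Basis. complex_of_real (max 0 (real n - norm y)) * cinner (k y) x = 0"
      by (intro AE_all_countable[THEN iffD2] allI AE_finite_allI finite_Basis AE)
    hence "AE y in lborel. k y = 0"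
    proof eventually_elim
      case (elim y)
      obtain n where n: "norm y < real n" using reals_Archimedean2 by blast
      have "max 0 (real n - norm y) \<noteq> 0" using n by simp
      hence "cinner (k y) x = 0" if "x \<in> Basis" for x
        using elim[rule_format, OF that, of n] by (simp only: mult_eq_0_iff of_real_eq_0_iff simp_thms)
      hence "k y \<bullet> x = 0" if "x \<in> Basis" for x
        using that by (simp add: inner_eq_Re_cinner)
      thus ?case using euclidean_all_zero_iff by blast
    qed
    hence "G = abs_L2 (\<lambda>_. 0)"
      using k by (simp add: abs_L2_eq_iff L2_fun_zero)
    thus False using G(1) by (simp add: zero_L2.abs_eq L2_eq_refl L2_fun_zero zero_L2_def)
  qed
  thus ?thesis by (auto simp: V_def)
qed

section \<open>The representation spaces as eigenspaces\<close>

text \<open>The values 1 and -1 of \<kappa> give the constants of \<open>H_minus\<close> and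
  \<open>H_plus\<close>, so that both spaces are treated at once.\<close>

definition twist_vec :: "complex \<Rightarrow> cliff2" where
  "twist_vec \<kappa> = e\<^sub>1 + \<i> *\<^sub>C e\<^sub>2 + \<kappa> *\<^sub>C (1 - \<i> *\<^sub>C (e\<^sub>1 * e\<^sub>2))"

definition H_twist :: "complex \<Rightarrow> (real^2, cliff2) L2 set" where
  "H_twist \<kappa> = {abs_L2 (spin_twist (twist_vec \<kappa>) \<alpha>) |\<alpha>. \<alpha> \<in> L2_fun}"

lemma H_minus_eq: "H_minus = H_twist 1"
  by (simp add: H_minus_def H_twist_def twist_vec_def add_diff_eq
      flip: scaleR_scaleC[of 1, simplified])

lemma H_plus_eq: "H_plus = H_twist (- 1)"
proof -
  have "(- 1) *\<^sub>C x = - x" for x :: cliff2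
    using scaleR_scaleC[of "- 1" x] by simp
  thus ?thesis by (simp only: H_plus_def H_twist_def twist_vec_def add_uminus_conv_diff)
qed

lemma twist_vec_eq: "twist_vec \<kappa> = Cliff \<kappa> 1 \<i> (- \<i> * \<kappa>)"
  by (simp add: twist_vec_def e1_def e2_def plus_cliff2_def minus_cliff2_def one_cliff2_def
      times_cliff2_def scaleC_cliff2_def)

text \<open>For nonzero \<open>y\<close> and \<open>\<kappa> * \<kappa> = 1\<close> this is the
  complex line in which the functions of \<open>H_twist \<kappa>\<close> take their value at
  \<open>y\<close>. Equations, rather than a spanning vector, make closedness and invariance easy;
  the factor \<open>norm y\<close> in the eigenvalue avoids normalizing \<open>y\<close>.\<close>

definition twist_line :: "complex \<Rightarrow> real^2 \<Rightarrow> cliff2 set" where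
  "twist_line \<kappa> y = {x. x * (e\<^sub>1 * e\<^sub>2) = \<i> *\<^sub>C x \<and>
     cliff_vec y * x = (- \<i> * \<kappa> * complex_of_real (norm y)) *\<^sub>C x}"

text \<open>In coordinates, the first equation determines the coefficients of
  \<open>e\<^sub>2\<close> and \<open>e\<^sub>1 * e\<^sub>2\<close> from the other two, and the
  second links those two through \<kappa>, leaving one free scalar.\<close>

lemma twist_vec_eigen:
  assumes "\<kappa> * \<kappa> = 1"
  shows "x * (e\<^sub>1 * e\<^sub>2) = \<i> *\<^sub>C x \<and> e\<^sub>2 * x = (- \<i> * \<kappa>) *\<^sub>C x \<longleftrightarrow> (\<exists>a. x = a *\<^sub>C twist_vec \<kappa>)"
    (is "?L \<longleftrightarrow> ?R")
proof
  obtain p q r t where x: "x = Cliff p q r t" by (cases x)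
  assume ?L
  moreover have "x * (e\<^sub>1 * e\<^sub>2) = Cliff (- t) r (- q) p" "e\<^sub>2 * x = Cliff (- r) t p (- q)"
    by (simp_all add: x e1_def e2_def times_cliff2_def)
  ultimately have "Cliff (- t) r (- q) p = \<i> *\<^sub>C x" "Cliff (- r) t p (- q) = (- \<i> * \<kappa>) *\<^sub>C x"
    by metis+
  hence t: "- t = \<i> * p" and r: "r = \<i> * q" and "- r = (- \<i> * \<kappa>) * p"
    by (simp_all only: x scaleC_cliff2_def cliff2.sel cliff2.inject)
  hence "\<i> * q = \<i> * (\<kappa> * p)" by simp
  hence "\<kappa> * q = (\<kappa> * \<kappa>) * p" by (simp only: mult_cancel_left complex_i_not_zero simp_thms mult.assoc)
  hence p: "p = q * \<kappa>" using assms by (simp add: mult.commute)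
  have "t = q * (- \<i> * \<kappa>)" using arg_cong[OF t, of uminus] by (simp add: p)
  hence "x = q *\<^sub>C twist_vec \<kappa>"
    by (simp add: x twist_vec_eq scaleC_cliff2_def p r)
  thus ?R ..
next
  assume ?R
  then obtain a where x: "x = a *\<^sub>C twist_vec \<kappa>" ..
  have "twist_vec \<kappa> * (e\<^sub>1 * e\<^sub>2) = \<i> *\<^sub>C twist_vec \<kappa>"
    by (simp add: twist_vec_eq e1_def e2_def times_cliff2_def scaleC_cliff2_def)
  moreover have "e\<^sub>2 * twist_vec \<kappa> = (- \<i> * \<kappa>) *\<^sub>C twist_vec \<kappa>"
    using assms by (simp add: twist_vec_eq e1_def e2_def times_cliff2_def scaleC_cliff2_def mult_ac)
  ultimately show ?L
    by (simp add: x scaleC_mult_cliff2 scaleC_scaleC mult.commute)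
qed

lemma cinner_twist_vec:
  assumes "\<kappa> = 1 \<or> \<kappa> = - 1"
  shows "cinner (twist_vec \<kappa>) (twist_vec \<kappa>) = 4"
  using assms by (auto simp: twist_vec_eq cinner_cliff2_def)

lemma cliff_vec_scaleR: "cliff_vec (r *\<^sub>R y) = r *\<^sub>R cliff_vec y"
  by (simp add: cliff_vec_def scaleR_add_right)

lemma spin_of_direction:
  assumes "y \<noteq> 0"
  obtains \<phi> where "spin_of (y /\<^sub>R norm y) = spin \<phi>"
    "cliff_vec y = norm y *\<^sub>R (spin \<phi> * e\<^sub>2 * spin (- \<phi>))"
proof -
  define \<omega> where "\<omega> = y /\<^sub>R norm y"
  have "norm \<omega> = 1" using assms by (simp add: \<omega>_def)
  hence "(- \<omega> $ 1)\<^sup>2 + (\<omega> $ 2)\<^sup>2 = 1"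
    by (simp add: norm_vec_def L2_set_def sum_2)
  \<comment> \<open>Rotating \<open>e\<^sub>2\<close> by the angle \<open>t\<close> gives the vector
    with coordinates - sin t and cos t. A spin element rotates by twice its own angle, hence
    \<open>t / 2\<close>, which lies in the range demanded by \<open>spin_of\<close>.\<close>
  then obtain t where t: "0 \<le> t" "t < 2 * pi" "- \<omega> $ 1 = sin t" "\<omega> $ 2 = cos t"
    using sincos_total_2pi[of "\<omega> $ 2" "- \<omega> $ 1"] by (auto simp: add.commute)
  hence \<omega>: "\<omega> = vector [- sin (2 * (t / 2)), cos (2 * (t / 2))]"
    by (simp add: vec_eq_iff forall_2)
  have 1: "spin_of \<omega> = spin (t / 2)"
    unfolding \<omega> by (rule spin_of_eq) (use t in auto)
  have e2: "e\<^sub>2 = cliff_vec (vector [0, 1])"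
    by (simp add: cliff_vec_eq e2_def)
  have 2: "spin (t / 2) * e\<^sub>2 * spin (- (t / 2)) = cliff_vec \<omega>"
    unfolding e2 \<omega> spin_conj_vec by simp
  have "y = norm y *\<^sub>R \<omega>" using assms by (simp add: \<omega>_def)
  hence "cliff_vec y = norm y *\<^sub>R cliff_vec \<omega>"
    by (metis cliff_vec_scaleR)
  with 1 2 that show ?thesis by (simp add: \<omega>_def)
qed

lemma spin_inverse: "spin (- \<phi>) * (spin \<phi> * x) = x" "spin \<phi> * (spin (- \<phi>) * x) = x"
  by (simp_all add: spin_mult flip: mult.assoc)

text \<open>Cancelling \<open>spin \<phi>\<close> on the left turns the eigenvalue equation for
  \<open>y\<close> into one for \<open>e\<^sub>2\<close> and commutes with the multiplication by
  \<open>e\<^sub>1 * e\<^sub>2\<close> on the right, so \<open>twist_vec_eigen\<close>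
  applies.\<close>

lemma twist_line_iff:
  assumes "\<kappa> * \<kappa> = 1" "y \<noteq> 0"
  shows "x \<in> twist_line \<kappa> y \<longleftrightarrow> (\<exists>a. x = spin_of (y /\<^sub>R norm y) * a *\<^sub>C twist_vec \<kappa>)"
proof -
  obtain \<phi> where \<phi>: "spin_of (y /\<^sub>R norm y) = spin \<phi>"
    "cliff_vec y = norm y *\<^sub>R (spin \<phi> * e\<^sub>2 * spin (- \<phi>))"
    by (rule spin_of_direction[OF assms(2)])
  define z where "z = spin (- \<phi>) * x"
  have x: "x = spin \<phi> * z" by (simp add: z_def spin_inverse)
  have inj: "spin \<phi> * u = spin \<phi> * v \<longleftrightarrow> u = v" for u v
    by (metis spin_inverse(1))
  have n: "norm y *\<^sub>R u = (a * complex_of_real (norm y)) *\<^sub>C v \<longleftrightarrow> u = a *\<^sub>C v" for a and u v :: cliff2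
  proof -
    have "(a * complex_of_real (norm y)) *\<^sub>C v = norm y *\<^sub>R (a *\<^sub>C v)"
      by (simp add: scaleR_scaleC scaleC_scaleC mult.commute)
    thus ?thesis using assms(2) by simp
  qed
  have "x * (e\<^sub>1 * e\<^sub>2) = \<i> *\<^sub>C x \<longleftrightarrow> z * (e\<^sub>1 * e\<^sub>2) = \<i> *\<^sub>C z"
    by (simp only: x mult.assoc scaleC_mult_cliff2(2)[symmetric] inj)
  moreover have "cliff_vec y * x = norm y *\<^sub>R (spin \<phi> * (e\<^sub>2 * z))"
    by (simp add: \<phi>(2) x mult.assoc spin_inverse scaleR_scaleC scaleC_mult_cliff2)
  hence "cliff_vec y * x = (- \<i> * \<kappa> * complex_of_real (norm y)) *\<^sub>C x \<longleftrightarrow>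
      e\<^sub>2 * z = (- \<i> * \<kappa>) *\<^sub>C z"
    by (simp only: n) (simp only: x scaleC_mult_cliff2(2)[symmetric] inj)
  ultimately have "x \<in> twist_line \<kappa> y \<longleftrightarrow> (\<exists>a. z = a *\<^sub>C twist_vec \<kappa>)"
    unfolding twist_line_def mem_Collect_eq by (simp only: twist_vec_eigen[OF assms(1)])
  thus ?thesis unfolding \<phi>(1) x inj .
qed

text \<open>Both are multiples, by \<open>a\<close> and \<open>a'\<close>, of one vector of squared
  norm 4, so their inner product is \<open>cnj a * (a' * 4)\<close>.\<close>

lemma twist_line_orthogonal:
  assumes \<kappa>: "\<kappa> = 1 \<or> \<kappa> = - 1" and "y \<noteq> 0" "x \<in> twist_line \<kappa> y" "x' \<in> twist_line \<kappa> y"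
    and "cinner x x' = 0"
  shows "x = 0 \<or> x' = 0"
proof -
  obtain \<phi> where \<phi>: "spin_of (y /\<^sub>R norm y) = spin \<phi>" by (rule spin_of_direction[OF assms(2)])
  have "\<kappa> * \<kappa> = 1" using \<kappa> by auto
  then obtain a a' where x: "x = spin \<phi> * a *\<^sub>C twist_vec \<kappa>" "x' = spin \<phi> * a' *\<^sub>C twist_vec \<kappa>"
    using assms twist_line_iff[of \<kappa> y] \<phi> by metis
  have "cinner x x' = cnj a * (a' * 4)"
    by (simp add: x cinner_spin_mult cinner_scaleC_left cinner_scaleC_right cinner_twist_vec[OF \<kappa>])
  hence "a = 0 \<or> a' = 0" using assms by simp
  moreover have "0 *\<^sub>C u = 0" for u :: cliff2 using scaleR_scaleC[of 0 u] by simp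
  ultimately show ?thesis by (auto simp: x)
qed

lemma closed_twist_line: "closed (twist_line \<kappa> y)"
  unfolding twist_line_def
  by (intro closed_Collect_conj closed_Collect_eq
      bounded_bilinear.continuous_on[OF bounded_bilinear_cliff_mult]
      bounded_linear.continuous_on[OF bounded_linear_scaleC] continuous_on_id continuous_on_const)

lemma cliff_vec_sim_map:
  "cliff_vec (sim_map r (spin \<theta>) y) = r *\<^sub>R (spin (- \<theta>) * cliff_vec y * spin \<theta>)"
  using cliff_vec_unvec_conj(2)[of "spin \<theta>" y]
  by (simp add: sim_map_def cliff_inv_spin Spin2_def cliff_vec_scaleR)

text \<open>\<open>sim_map\<close> conjugates the vector by the inverse spin element, so left
  multiplication by \<open>spin \<theta>\<close> carries its eigenvectors to those of
  \<open>y\<close>. The dilation scales vector and eigenvalue alike and cancels.\<close>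

lemma twist_line_sim:
  assumes "r > 0" "x \<in> twist_line \<kappa> (sim_map r (spin \<theta>) y)"
  shows "c *\<^sub>C r *\<^sub>R (spin \<theta> * x) \<in> twist_line \<kappa> y"
proof -
  from assms have x: "x * (e\<^sub>1 * e\<^sub>2) = \<i> *\<^sub>C x"
    "r *\<^sub>R (spin (- \<theta>) * (cliff_vec y * (spin \<theta> * x))) =
     r *\<^sub>R ((- \<i> * \<kappa> * complex_of_real (norm y)) *\<^sub>C x)"
    by (simp_all add: twist_line_def norm_sim_map cliff_vec_sim_map mult.assoc scaleR_scaleC
        scaleC_scaleC scaleC_mult_cliff2 mult_ac)
  hence "spin (- \<theta>) * (cliff_vec y * (spin \<theta> * x)) = (- \<i> * \<kappa> * complex_of_real (norm y)) *\<^sub>C x"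
    using assms(1) by simp
  hence "cliff_vec y * (spin \<theta> * x) = (- \<i> * \<kappa> * complex_of_real (norm y)) *\<^sub>C (spin \<theta> * x)"
    by (metis spin_inverse(2) scaleC_mult_cliff2(2))
  thus ?thesis
    using x(1) by (simp add: twist_line_def scaleR_scaleC scaleC_scaleC scaleC_mult_cliff2 mult.assoc)
      (simp add: mult_ac)
qed

text \<open>Lebesgue measure is a positive multiple of its image under a similitude, so null sets
  pull back to null sets.\<close>

lemma AE_lborel_sim_map:
  assumes r: "r > 0" and "AE y in lborel. P y"
  shows "AE y in lborel. P (sim_map r (spin \<theta>) y)"
proof -
  have "AE y in density (distr lborel borel (sim_map r (spin \<theta>))) (\<lambda>_. ennreal (r\<^sup>2)). P y"
    unfolding lborel_sim_map[OF r, of \<theta>, symmetric] by (rule assms(2))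
  hence "AE y in distr lborel borel (sim_map r (spin \<theta>)). P y"
    using r by (simp add: AE_density)
  thus ?thesis by (rule AE_distrD[rotated]) simp
qed

section \<open>Almost everywhere description and basic properties of the representation
  spaces\<close>

lemma L2_fun_indicator:
  fixes A :: "'a::euclidean_space set"
  assumes "bounded A" "A \<in> sets borel"
  shows "(\<lambda>y. complex_of_real (indicator A y)) \<in> L2_fun"
proof -
  have "integrable lborel (indicator A :: _ \<Rightarrow> real)"
    using emeasure_bounded_finite[OF assms(1)] assms(2) by (intro integrable_real_indicator) auto
  moreover have "(cmod (complex_of_real (indicator A y)))\<^sup>2 = indicator A y" for y
    by (simp add: indicator_def)
  ultimately show ?thesis using assms(2) by (simp add: L2_fun_def)
qed

text \<open>Truncated to balls, the function is square integrable by
  \<open>spin_twist_L2_fun\<close>, hence measurable; at each point the truncations are eventually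
  constant.\<close>

lemma spin_of_direction_measurable [measurable]:
  "(\<lambda>y. spin_of (y /\<^sub>R norm y)) \<in> borel_measurable borel"
proof (rule borel_measurable_LIMSEQ_metric)
  fix n :: nat
  show "spin_twist 1 (\<lambda>y. complex_of_real (indicator (cball 0 (real n)) y)) \<in> borel_measurable borel"
    by (intro L2_fun_measurable spin_twist_L2_fun L2_fun_indicator) auto
next
  fix y :: "real^2"
  have "\<forall>\<^sub>F n in sequentially. norm y \<le> real n"
    using eventually_ge_at_top[of "nat \<lceil>norm y\<rceil>"] by eventually_elim (simp add: nat_ceiling_le_eq)
  hence "\<forall>\<^sub>F n in sequentially. spin_twist 1 (\<lambda>y. complex_of_real (indicator (cball 0 (real n)) y)) y = spin_of (y /\<^sub>R norm y)"
    by eventually_elim (simp add: spin_twist_def flip: scaleR_scaleC[of 1, simplified])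
  thus "(\<lambda>n. spin_twist 1 (\<lambda>y. complex_of_real (indicator (cball 0 (real n)) y)) y) \<longlonglongrightarrow> spin_of (y /\<^sub>R norm y)"
    by (rule tendsto_eventually)
qed

lemma AE_lborel_nonzero: "AE y in lborel. (y :: real^2) \<noteq> 0"
  using AE_lborel_singleton[of "0 :: real^2"] by eventually_elim simp

lemma H_twist_iff:
  assumes \<kappa>: "\<kappa> = 1 \<or> \<kappa> = - 1"
  shows "F \<in> H_twist \<kappa> \<longleftrightarrow> (AE y in lborel. rep_L2 F y \<in> twist_line \<kappa> y)"
proof
  have \<kappa>2: "\<kappa> * \<kappa> = 1" using \<kappa> by auto
  {
    assume "F \<in> H_twist \<kappa>"
    then obtain \<alpha> where \<alpha>: "\<alpha> \<in> L2_fun" "F = abs_L2 (spin_twist (twist_vec \<kappa>) \<alpha>)"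
      by (auto simp: H_twist_def)
    have "AE y in lborel. rep_L2 F y = spin_twist (twist_vec \<kappa>) \<alpha> y"
      unfolding \<alpha>(2) by (rule rep_abs_L2_AE[OF spin_twist_L2_fun[OF \<alpha>(1)]])
    thus "AE y in lborel. rep_L2 F y \<in> twist_line \<kappa> y"
      using AE_lborel_nonzero
      by eventually_elim (auto simp: twist_line_iff[OF \<kappa>2] spin_twist_def)
  next
    assume AE: "AE y in lborel. rep_L2 F y \<in> twist_line \<kappa> y"
    \<comment> \<open>The inner product with the spanning vector of the line, divided by its squared
      norm 4, recovers the coefficient. Unlike an arbitrary pointwise choice, this formula is
      measurable.\<close>
    define \<alpha> where "\<alpha> y = cinner (spin_of (y /\<^sub>R norm y) * twist_vec \<kappa>) (rep_L2 F y) / 4" for y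
    note [measurable] = L2_fun_measurable[OF rep_L2_fun[of F]]
    have m [measurable]: "\<alpha> \<in> borel_measurable borel"
      unfolding \<alpha>_def by measurable
    have AE2: "AE y in lborel. rep_L2 F y = spin_twist (twist_vec \<kappa>) \<alpha> y
        \<and> (norm (rep_L2 F y))\<^sup>2 / 4 = (cmod (\<alpha> y))\<^sup>2"
      using AE AE_lborel_nonzero
    proof eventually_elim
      case (elim y)
      obtain \<phi> where \<phi>: "spin_of (y /\<^sub>R norm y) = spin \<phi>" by (rule spin_of_direction[OF elim(2)])
      obtain a where a: "rep_L2 F y = spin \<phi> * a *\<^sub>C twist_vec \<kappa>"
        using elim twist_line_iff[OF \<kappa>2] \<phi> by metis
      have "\<alpha> y = a"
        by (simp add: \<alpha>_def a \<phi> cinner_spin_mult cinner_scaleC_right cinner_twist_vec[OF \<kappa>])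
      moreover have "(norm (twist_vec \<kappa>))\<^sup>2 = 4"
        using cinner_twist_vec[OF \<kappa>] by (metis cinner_self of_real_eq_iff of_real_numeral)
      ultimately show ?case
        by (simp add: a \<phi> spin_twist_def norm_spin_mult power_mult_distrib)
    qed
    have "integrable lborel (\<lambda>y. (cmod (\<alpha> y))\<^sup>2)"
    proof (rule integrable_cong_AE_imp)
      show "integrable lborel (\<lambda>y. (norm (rep_L2 F y))\<^sup>2 / 4)"
        using rep_L2_fun[of F] by (simp add: L2_fun_def)
      show "AE y in lborel. (norm (rep_L2 F y))\<^sup>2 / 4 = (cmod (\<alpha> y))\<^sup>2"
        using AE2 by eventually_elim blast
    qed simp
    hence \<alpha>: "\<alpha> \<in> L2_fun" by (simp add: L2_fun_def)
    have "abs_L2 (rep_L2 F) = abs_L2 (spin_twist (twist_vec \<kappa>) \<alpha>)"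
      unfolding abs_L2_eq_iff[OF rep_L2_fun spin_twist_L2_fun[OF \<alpha>]]
      using AE2 by eventually_elim blast
    thus "F \<in> H_twist \<kappa>" using \<alpha> by (auto simp: H_twist_def)
  }
qed

lemma closed_H_twist: "\<kappa> = 1 \<or> \<kappa> = - 1 \<Longrightarrow> closed (H_twist \<kappa>)"
  using closed_L2_AE[of "twist_line \<kappa>", OF closed_twist_line] by (simp add: H_twist_iff[symmetric])

lemma csubspace_H_twist: "csubspace (H_twist \<kappa>)"
  unfolding csubspace_def
proof (intro conjI ballI allI)
  let ?t = "spin_twist (twist_vec \<kappa>)"
  have "?t (\<lambda>_. 0) = (\<lambda>_. 0)"
    using scaleR_scaleC[of 0 "twist_vec \<kappa>"] by (simp add: spin_twist_def fun_eq_iff)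
  thus "0 \<in> H_twist \<kappa>"
    unfolding H_twist_def zero_L2_def by (intro CollectI exI[of _ "\<lambda>_. 0"]) (simp add: L2_fun_zero)
  fix F G assume "F \<in> H_twist \<kappa>" "G \<in> H_twist \<kappa>"
  then obtain \<alpha> \<beta> where \<alpha>: "\<alpha> \<in> L2_fun" "F = abs_L2 (?t \<alpha>)" and \<beta>: "\<beta> \<in> L2_fun" "G = abs_L2 (?t \<beta>)"
    by (auto simp: H_twist_def)
  have "?t (\<lambda>y. \<alpha> y + \<beta> y) = (\<lambda>y. ?t \<alpha> y + ?t \<beta> y)"
    by (simp add: spin_twist_def fun_eq_iff scaleC_add_left distrib_left)
  hence "F + G = abs_L2 (?t (\<lambda>y. \<alpha> y + \<beta> y))"
    using \<alpha> \<beta> by (simp add: abs_L2_add spin_twist_L2_fun)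
  thus "F + G \<in> H_twist \<kappa>"
    using L2_fun_add[OF \<alpha>(1) \<beta>(1)] by (auto simp: H_twist_def)
next
  let ?t = "spin_twist (twist_vec \<kappa>)"
  fix c F assume "F \<in> H_twist \<kappa>"
  then obtain \<alpha> where \<alpha>: "\<alpha> \<in> L2_fun" "F = abs_L2 (?t \<alpha>)"
    by (auto simp: H_twist_def)
  have "?t (\<lambda>y. c * \<alpha> y) = (\<lambda>y. c *\<^sub>C ?t \<alpha> y)"
    by (simp add: spin_twist_def fun_eq_iff scaleC_mult_cliff2 scaleC_scaleC)
  hence "c *\<^sub>C F = abs_L2 (?t (\<lambda>y. c * \<alpha> y))"
    using \<alpha> by (simp add: abs_L2_scaleC spin_twist_L2_fun)
  moreover have "(\<lambda>y. c * \<alpha> y) \<in> L2_fun"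
    using \<alpha>(1) by (auto simp: L2_fun_def norm_mult power_mult_distrib)
  ultimately show "c *\<^sub>C F \<in> H_twist \<kappa>"
    by (auto simp: H_twist_def)
qed

lemma sim_rep_H_twist:
  assumes \<kappa>: "\<kappa> = 1 \<or> \<kappa> = - 1" and g: "g \<in> carrier spin_sim" and F: "F \<in> H_twist \<kappa>"
  shows "sim_rep g F \<in> H_twist \<kappa>"
proof -
  obtain r \<theta> b where g': "g = (r, spin \<theta>, b)" "r > 0" by (rule spin_sim_cases[OF g])
  have "AE y in lborel. rep_L2 F (sim_map r (spin \<theta>) y) \<in> twist_line \<kappa> (sim_map r (spin \<theta>) y)"
    using F \<kappa> g' by (intro AE_lborel_sim_map) (simp_all add: H_twist_iff)
  moreover have "AE y in lborel. rep_L2 (sim_rep g F) y = sim_fun g (rep_L2 F) y"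
    unfolding sim_rep_def by (intro rep_abs_L2_AE sim_fun_L2_fun g rep_L2_fun)
  ultimately have "AE y in lborel. rep_L2 (sim_rep g F) y \<in> twist_line \<kappa> y"
    by eventually_elim (simp add: g' sim_fun_eq twist_line_sim)
  thus ?thesis using \<kappa> by (simp add: H_twist_iff)
qed

lemma H_twist_nontrivial:
  assumes \<kappa>: "\<kappa> = 1 \<or> \<kappa> = - 1"
  shows "H_twist \<kappa> \<noteq> {0}"
proof
  assume triv: "H_twist \<kappa> = {0}"
  define \<alpha> where "\<alpha> y = complex_of_real (indicator (ball 0 1) y)" for y :: "real^2"
  have \<alpha>: "\<alpha> \<in> L2_fun"
    unfolding \<alpha>_def by (rule L2_fun_indicator) auto
  have "abs_L2 (spin_twist (twist_vec \<kappa>) \<alpha>) = abs_L2 (\<lambda>_. 0)"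
    using triv \<alpha> unfolding H_twist_def zero_L2_def by blast
  hence "AE y in lborel. spin_twist (twist_vec \<kappa>) \<alpha> y = 0"
    by (simp add: abs_L2_eq_iff[OF spin_twist_L2_fun[OF \<alpha>] L2_fun_zero])
  hence "AE y in lborel. y \<notin> (ball 0 1 :: (real^2) set)"
    using AE_lborel_nonzero
  proof eventually_elim
    case (elim y)
    obtain \<phi> where \<phi>: "spin_of (y /\<^sub>R norm y) = spin \<phi>" by (rule spin_of_direction[OF elim(2)])
    have "norm (spin_twist (twist_vec \<kappa>) \<alpha> y) = cmod (\<alpha> y) * norm (twist_vec \<kappa>)"
      by (simp add: spin_twist_def \<phi> norm_spin_mult)
    moreover have "norm (twist_vec \<kappa>) \<noteq> 0"
      by (auto simp: twist_vec_eq zero_cliff2_def)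
    ultimately show ?case using elim(1) by (auto simp: \<alpha>_def indicator_def)
  qed
  hence "emeasure lborel (ball 0 1 :: (real^2) set) = 0"
    by (subst (asm) AE_iff_null_sets[symmetric]) auto
  thus False
    using content_ball_pos[of 1 "0 :: real^2"] by (simp add: measure_def)
qed

section \<open>Unitarity and irreducibility\<close>

text \<open>Surjectivity of the restricted operators comes from the inverse group elements, which
  leave \<open>K\<close> invariant too.\<close>

lemma unitary_rep_subspace:
  assumes H: "unitary_rep G H \<pi>" and K: "K \<subseteq> H" "csubspace K" "closed K"
    and inv: "\<And>g x. g \<in> carrier G \<Longrightarrow> x \<in> K \<Longrightarrow> \<pi> g x \<in> K"
  shows "unitary_rep G K \<pi>"
proof -
  interpret group G using H by (simp add: unitary_rep_def)
  have mult: "\<pi> (g \<otimes>\<^bsub>G\<^esub> h) x = \<pi> g (\<pi> h x)"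
    if "g \<in> carrier G" "h \<in> carrier G" "x \<in> H" for g h x
    using H that by (simp add: unitary_rep_def)
  \<comment> \<open>The neutral element acts as an idempotent that is onto \<open>H\<close>, hence
    as the identity.\<close>
  have one: "\<pi> \<one>\<^bsub>G\<^esub> x = x" if "x \<in> H" for x
  proof -
    have "x \<in> \<pi> \<one>\<^bsub>G\<^esub> ` H" using H that by (simp add: unitary_rep_def unitary_map_def)
    then obtain y where "x = \<pi> \<one>\<^bsub>G\<^esub> y" "y \<in> H" by (rule imageE)
    thus ?thesis using mult[of "\<one>\<^bsub>G\<^esub>" "\<one>\<^bsub>G\<^esub>" y] by simp
  qed
  have "complete K"
    using complete_Int_closed[of H K] H K by (simp add: unitary_rep_def Int_absorb1)
  moreover have "unitary_map K K (\<pi> g)" if g: "g \<in> carrier G" for g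
  proof -
    have "x \<in> \<pi> g ` K" if "x \<in> K" for x
    proof -
      have "x = \<pi> g (\<pi> (inv\<^bsub>G\<^esub> g) x)"
        using mult[of g "inv\<^bsub>G\<^esub> g" x] one[of x] g that K(1) by auto
      thus ?thesis using inv[of "inv\<^bsub>G\<^esub> g" x] g that by blast
    qed
    hence "\<pi> g ` K = K" using inv g by blast
    moreover have "unitary_map H H (\<pi> g)" using H g by (simp add: unitary_rep_def)
    ultimately show ?thesis
      using K(1) by (simp add: unitary_map_def subset_eq)
  qed
  ultimately show ?thesis
    using H K by (simp add: unitary_rep_def subset_eq)
qed

lemma unitary_rep_L2: "unitary_rep spin_sim UNIV sim_rep"
proof -
  interpret group spin_sim by (rule group_spin_sim)
  have "range (sim_rep g) = UNIV" if g: "g \<in> carrier spin_sim" for g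
  proof -
    have "sim_rep g (sim_rep (inv\<^bsub>spin_sim\<^esub> g) F) = F" for F
      using sim_rep_mult[of g "inv\<^bsub>spin_sim\<^esub> g" F] g by (simp add: sim_rep_one)
    thus ?thesis by (metis surjI)
  qed
  hence "unitary_map UNIV UNIV (sim_rep g)" if "g \<in> carrier spin_sim" for g
    using that by (simp add: unitary_map_def sim_rep_add sim_rep_scaleC cinner_sim_rep)
  thus ?thesis
    by (simp add: unitary_rep_def group_spin_sim csubspace_def complete_L2 sim_rep_mult
        continuous_on_sim_rep)
qed

lemma unitary_rep_H_twist:
  assumes "\<kappa> = 1 \<or> \<kappa> = - 1"
  shows "unitary_rep spin_sim (H_twist \<kappa>) sim_rep"
  by (rule unitary_rep_subspace[OF unitary_rep_L2])
    (simp_all add: csubspace_H_twist closed_H_twist[OF assms] sim_rep_H_twist[OF assms])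

text \<open>Complex multiplication of \<open>y\<close> by \<open>z\<close>: parametrizing the similitudes by \<open>z \<noteq> 0\<close> makes
  the roles of \<open>y\<close> and \<open>z\<close> symmetric, so that null sets can be swapped by Fubini.\<close>

definition plane_mult :: "real^2 \<Rightarrow> real^2 \<Rightarrow> real^2" where
  "plane_mult z y = (\<chi> i. if i = 1 then z $ 1 * y $ 1 - z $ 2 * y $ 2 else z $ 1 * y $ 2 + z $ 2 * y $ 1)"

lemma plane_mult_commute: "plane_mult z y = plane_mult y z"
  by (simp add: plane_mult_def vec_eq_iff mult.commute add.commute)

lemma plane_mult_sim_map:
  assumes "z \<noteq> 0"
  obtains r \<theta> where "r > 0" "plane_mult z = sim_map r (spin \<theta>)"
proof -
  \<comment> \<open>\<open>sim_map\<close> rotates by the angle \<open>- 2 * \<theta>\<close>, so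
    polar coordinates are taken of the complex conjugate of \<open>z\<close>.\<close>
  define w where "w = Complex (z $ 1) (- z $ 2)"
  have "w \<noteq> 0" using assms by (auto simp: w_def vec_eq_iff forall_2 complex_eq_iff)
  define r \<theta> where "r = cmod w" and "\<theta> = Arg w / 2"
  have "w = rcis r (2 * \<theta>)" by (simp add: r_def \<theta>_def rcis_cmod_Arg)
  hence "z $ 1 = r * cos (2 * \<theta>)" "- z $ 2 = r * sin (2 * \<theta>)"
    by (simp_all add: w_def complex_eq_iff)
  moreover from this have "z $ 2 = - (r * sin (2 * \<theta>))" by linarith
  ultimately have "plane_mult z = sim_map r (spin \<theta>)"
    by (simp add: fun_eq_iff plane_mult_def sim_map_spin vec_eq_iff forall_2 algebra_simps)
  moreover have "r > 0" using \<open>w \<noteq> 0\<close> by (simp add: r_def)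
  ultimately show ?thesis using that by blast
qed

lemma plane_mult_measurable [measurable]:
  "(\<lambda>p. plane_mult (fst p) (snd p)) \<in> borel_measurable (borel \<Otimes>\<^sub>M borel)"
proof -
  have "continuous_on UNIV (\<lambda>p :: (real^2) \<times> (real^2). plane_mult (fst p) (snd p))"
    unfolding plane_mult_def
  proof (rule continuous_on_vec_lambda)
    fix i :: 2
    show "continuous_on UNIV (\<lambda>p :: (real^2) \<times> (real^2). if i = 1 then fst p $ 1 * snd p $ 1 - fst p $ 2 * snd p $ 2
        else fst p $ 1 * snd p $ 2 + fst p $ 2 * snd p $ 1)"
      by (cases "i = 1") (auto intro!: continuous_intros)
  qed
  thus ?thesis
    unfolding borel_prod by (rule borel_measurable_continuous_onI)
qed

lemma irreducible_H_twist:
  assumes \<kappa>: "\<kappa> = 1 \<or> \<kappa> = - 1"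
  shows "irreducible_unitary_rep spin_sim (H_twist \<kappa>) sim_rep"
  unfolding irreducible_unitary_rep_def
proof (intro conjI allI impI)
  show rep: "unitary_rep spin_sim (H_twist \<kappa>) sim_rep" by (rule unitary_rep_H_twist[OF \<kappa>])
  show "H_twist \<kappa> \<noteq> {0}" by (rule H_twist_nontrivial[OF \<kappa>])
  fix V assume "V \<subseteq> H_twist \<kappa> \<and> csubspace V \<and> closed V \<and> (\<forall>g\<in>carrier spin_sim. sim_rep g ` V \<subseteq> V)"
  hence VH: "V \<subseteq> H_twist \<kappa>" and V: "csubspace V" "closed V"
    and inv: "\<forall>g\<in>carrier spin_sim. sim_rep g ` V \<subseteq> V"
    by blast+
  show "V = {0} \<or> V = H_twist \<kappa>"
  proof (rule ccontr)
    assume *: "\<not> (V = {0} \<or> V = H_twist \<kappa>)"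
    moreover have "0 \<in> V" using V(1) by (simp add: csubspace_def)
    ultimately obtain F where F: "F \<in> V" "F \<noteq> 0" by blast
    have "complete (H_twist \<kappa>)" using rep by (simp add: unitary_rep_def)
    then obtain G where G: "G \<in> H_twist \<kappa>" "G \<noteq> 0" "\<And>F. F \<in> V \<Longrightarrow> cinner G F = 0"
      using orthogonal_vector_exists[OF _ csubspace_H_twist V(2,1) VH] * by metis
    define f k where "f = rep_L2 F" and "k = rep_L2 G"
    have f: "f \<in> L2_fun" "F = abs_L2 f" and k: "k \<in> L2_fun" "G = abs_L2 k"
      by (simp_all add: f_def k_def rep_L2_fun)
    have [measurable]: "f \<in> borel_measurable borel" "k \<in> borel_measurable borel"
      using f k by (simp_all add: L2_fun_measurable)
    have f_line: "AE y in lborel. f y \<in> twist_line \<kappa> y" and k_line: "AE y in lborel. k y \<in> twist_line \<kappa> y"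
      using F(1) G(1) VH unfolding f_def k_def H_twist_iff[OF \<kappa>, symmetric] by auto
    have nonzero: "\<not> (AE y in lborel. rep_L2 F' y = 0)" if "F' \<noteq> 0" for F' :: "(real^2, cliff2) L2"
    proof
      assume "AE y in lborel. rep_L2 F' y = 0"
      hence "abs_L2 (rep_L2 F') = abs_L2 (\<lambda>_. 0)"
        by (simp only: abs_L2_eq_iff[OF rep_L2_fun L2_fun_zero])
      thus False using that by (simp add: zero_L2_def)
    qed
    \<comment> \<open>With dilation and rotation fixed, letting the translation vary yields the
      whole Fourier transform of the pointwise inner product of \<open>k\<close> and
      \<open>h\<close>.\<close>
    have disj: "AE y in lborel. k y = 0 \<or> f (sim_map r (spin \<theta>) y) = 0" if r: "r > 0" for r \<theta>
    proof -
      define h where "h = sim_fun (r, spin \<theta>, 0) f"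
      have carrier: "(r, spin \<theta>, b) \<in> carrier spin_sim" for b
        using r by (simp add: spin_sim_def Spin2_def)
      have h: "h \<in> L2_fun" unfolding h_def by (rule sim_fun_L2_fun[OF carrier f(1)])
      have "(LINT y|lborel. cis (b \<bullet> y) * cinner (k y) (h y)) = 0" for b
      proof -
        \<comment> \<open>Division by \<open>2 * pi\<close> converts the character of the
          representation to the normalization in \<open>fourier_null\<close>.\<close>
        let ?g = "(r, spin \<theta>, b /\<^sub>R (2 * pi))"
        have "cinner G (sim_rep ?g F) = 0"
          using inv carrier F(1) by (intro G(3)) blast
        moreover have "sim_fun ?g f y = cis (b \<bullet> y) *\<^sub>C h y" for y
        proof -
          have "2 * pi * ((b /\<^sub>R (2 * pi)) \<bullet> y) = b \<bullet> y" by (simp add: field_simps)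
          thus ?thesis
            unfolding h_def sim_fun_eq by (simp only:) (simp flip: scaleR_scaleC[of 1, simplified])
        qed
        ultimately show ?thesis
          using f k carrier[of "b /\<^sub>R (2 * pi)"] sim_fun_L2_fun[OF carrier f(1), of "b /\<^sub>R (2 * pi)"]
          by (simp add: sim_rep_abs cinner_abs_L2 cinner_scaleC_right)
      qed
      hence "(\<lambda>y. cinner (k y) (h y)) \<in> fourier_null"
        using integrable_cinner[OF k(1) h] by (simp add: fourier_null_def)
      hence "AE y in lborel. cinner (k y) (h y) = 0" by (rule fourier_null_AE_0)
      moreover have "AE y in lborel. f (sim_map r (spin \<theta>) y) \<in> twist_line \<kappa> (sim_map r (spin \<theta>) y)"
        by (rule AE_lborel_sim_map[OF r f_line])
      ultimately show ?thesis
        using k_line AE_lborel_nonzero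
      proof eventually_elim
        case (elim y)
        have "h y \<in> twist_line \<kappa> y"
          unfolding h_def sim_fun_eq by (rule twist_line_sim[OF r elim(2)])
        hence "k y = 0 \<or> h y = 0"
          using twist_line_orthogonal[OF \<kappa> elim(4,3)] elim(1) by blast
        moreover have "norm (h y) = r * norm (f (sim_map r (spin \<theta>) y))"
          using r by (simp add: h_def sim_fun_eq norm_spin_mult)
        ultimately show ?case using r by auto
      qed
    qed
    \<comment> \<open>The exceptional null set of \<open>y\<close> depends on \<open>z\<close>.
      Fubini's theorem exchanges the two, so that one fixed \<open>y\<close> with \<open>k y\<close>
      nonzero serves for almost every \<open>z\<close>.\<close>
    have "AE z in lborel. AE y in lborel. k y = 0 \<or> f (plane_mult z y) = 0"
      using AE_lborel_nonzero
    proof eventually_elim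
      case (elim z)
      then obtain r \<theta> where "r > 0" "plane_mult z = sim_map r (spin \<theta>)"
        by (rule plane_mult_sim_map)
      thus ?case using disj by simp
    qed
    moreover have "Measurable.pred (lborel \<Otimes>\<^sub>M lborel) (\<lambda>p. k (snd p) = 0 \<or> f (plane_mult (fst p) (snd p)) = 0)"
      by measurable
    ultimately have "AE y in lborel. AE z in lborel. k y = 0 \<or> f (plane_mult z y) = 0"
      by (subst lborel_pair.AE_commute[symmetric]) (simp_all add: pred_def)
    moreover have "\<not> (AE y in lborel. k y = 0)"
      using nonzero[OF G(2)] by (simp add: k_def)
    ultimately obtain y where y: "y \<noteq> 0" "AE z in lborel. f (plane_mult z y) = 0"
    proof (rule_tac ccontr)
      assume none: "\<not> thesis"
      \<comment> \<open>If no nonzero \<open>y\<close> qualified, \<open>k\<close> would vanish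
        almost everywhere.\<close>
      have "AE y in lborel. k y = 0"
        using \<open>AE y in lborel. AE z in lborel. k y = 0 \<or> f (plane_mult z y) = 0\<close> AE_lborel_nonzero
      proof eventually_elim
        case (elim y)
        show ?case
        proof (rule ccontr)
          assume "k y \<noteq> 0"
          hence "AE z in lborel. f (plane_mult z y) = 0" using elim(1) by simp
          thus False using none that elim(2) by blast
        qed
      qed
      thus False using \<open>\<not> (AE y in lborel. k y = 0)\<close> by blast
    qed
    \<comment> \<open>By commutativity, \<open>plane_mult z y\<close> with \<open>y\<close> fixed is
      a similitude in \<open>z\<close>; undoing it shows that \<open>f\<close> itself vanishes
      almost everywhere.\<close>
    obtain r \<theta> where r: "r > 0" "plane_mult y = sim_map r (spin \<theta>)"
      by (rule plane_mult_sim_map[OF y(1)])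
    have 0: "AE z in lborel. f (sim_map r (spin \<theta>) z) = 0"
      using y(2) unfolding plane_mult_commute[of _ y] r(2) .
    have "AE z in lborel. f z = 0"
      using AE_lborel_sim_map[OF _ 0, of "1 / r" "- \<theta>"] r(1) by (simp add: sim_map_inverse)
    thus False using nonzero[OF F(2)] by (simp add: f_def)
  qed
qed

section \<open>Equivalence\<close>

text \<open>This is the negative of the grade involution of the Clifford algebra.\<close>

definition even_neg :: "cliff2 \<Rightarrow> cliff2" where
  "even_neg x = Cliff (- cf_0 x) (cf_1 x) (cf_2 x) (- cf_12 x)"

lemma even_neg_add: "even_neg (x + y) = even_neg x + even_neg y"
  by (simp add: even_neg_def plus_cliff2_def)

lemma even_neg_scaleC: "even_neg (c *\<^sub>C x) = c *\<^sub>C even_neg x"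
  by (simp add: even_neg_def scaleC_cliff2_def)

lemma even_neg_scaleR: "even_neg (r *\<^sub>R x) = r *\<^sub>R even_neg x"
  by (simp add: scaleR_scaleC even_neg_scaleC)

text \<open>Spin elements are even, so left multiplication by them preserves the even and the odd
  part.\<close>

lemma even_neg_spin: "even_neg (spin \<theta> * x) = spin \<theta> * even_neg x"
  by (simp add: even_neg_def spin_eq times_cliff2_def)

lemma even_neg_twist_vec: "even_neg (twist_vec \<kappa>) = twist_vec (- \<kappa>)"
  by (simp add: even_neg_def twist_vec_eq)

lemma cinner_even_neg: "cinner (even_neg x) (even_neg y) = cinner x y"
  by (simp add: even_neg_def cinner_cliff2_def)

lemma norm_even_neg: "norm (even_neg x) = norm x"
  by (simp add: norm_eq_sqrt_inner inner_eq_Re_cinner cinner_even_neg)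

lemma even_neg_L2_fun:
  assumes "f \<in> L2_fun"
  shows "(\<lambda>y. even_neg (f y)) \<in> L2_fun"
proof -
  have [measurable]: "f \<in> borel_measurable borel" using assms by (rule L2_fun_measurable)
  have "(\<lambda>y. even_neg (f y)) \<in> borel_measurable lborel"
    unfolding even_neg_def by (intro borel_measurable_Cliff borel_measurable_uminus borel_measurable_cf) simp_all
  thus ?thesis using assms by (simp add: L2_fun_def norm_even_neg)
qed

definition even_neg_L2 :: "(real^2, cliff2) L2 \<Rightarrow> (real^2, cliff2) L2" where
  "even_neg_L2 F = abs_L2 (\<lambda>y. even_neg (rep_L2 F y))"

lemma even_neg_L2_abs:
  assumes "f \<in> L2_fun"
  shows "even_neg_L2 (abs_L2 f) = abs_L2 (\<lambda>y. even_neg (f y))"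
  unfolding even_neg_L2_def abs_L2_eq_iff[OF even_neg_L2_fun[OF rep_L2_fun] even_neg_L2_fun[OF assms]]
  using rep_abs_L2_AE[OF assms] by eventually_elim simp

text \<open>Only the constant vector changes while the coefficient \<alpha> stays the same, so every
  element of the target space is reached.\<close>

lemma unitary_map_even_neg_L2: "unitary_map (H_twist \<kappa>) (H_twist (- \<kappa>)) even_neg_L2"
  unfolding unitary_map_def
proof (intro conjI ballI allI)
  have twist: "even_neg_L2 (abs_L2 (spin_twist (twist_vec \<kappa>) \<alpha>)) = abs_L2 (spin_twist (twist_vec (- \<kappa>)) \<alpha>)"
    if \<alpha>: "\<alpha> \<in> L2_fun" for \<alpha>
  proof -
    \<comment> \<open>At \<open>y = 0\<close> the value of \<open>spin_of\<close> is unspecified and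
      need not be even, so the identity is claimed only almost everywhere.\<close>
    have "AE y in lborel. even_neg (spin_twist (twist_vec \<kappa>) \<alpha> y) = spin_twist (twist_vec (- \<kappa>)) \<alpha> y"
      using AE_lborel_nonzero
    proof eventually_elim
      case (elim y)
      obtain \<phi> where \<phi>: "spin_of (y /\<^sub>R norm y) = spin \<phi>" by (rule spin_of_direction[OF elim])
      show ?case by (simp add: spin_twist_def \<phi> even_neg_spin even_neg_scaleC even_neg_twist_vec)
    qed
    thus ?thesis
      by (simp add: even_neg_L2_abs spin_twist_L2_fun \<alpha> abs_L2_eq_iff even_neg_L2_fun)
  qed
  show "even_neg_L2 ` H_twist \<kappa> = H_twist (- \<kappa>)"
    unfolding H_twist_def using twist by (force simp: image_iff)
next
  fix F G :: "(real^2, cliff2) L2" and c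
  obtain f g where f: "f \<in> L2_fun" "F = abs_L2 f" and g: "g \<in> L2_fun" "G = abs_L2 g"
    by (metis L2_cases)
  show "even_neg_L2 (F + G) = even_neg_L2 F + even_neg_L2 G"
    using f g by (simp add: abs_L2_add even_neg_L2_abs L2_fun_add even_neg_L2_fun even_neg_add)
  show "even_neg_L2 (c *\<^sub>C F) = c *\<^sub>C even_neg_L2 F"
    using f by (simp add: abs_L2_scaleC even_neg_L2_abs L2_fun_scaleC even_neg_L2_fun even_neg_scaleC)
  show "cinner (even_neg_L2 F) (even_neg_L2 G) = cinner F G"
    using f g by (simp add: cinner_abs_L2 even_neg_L2_abs even_neg_L2_fun cinner_even_neg)
qed

lemma even_neg_L2_sim_rep:
  assumes g: "g \<in> carrier spin_sim"
  shows "even_neg_L2 (sim_rep g F) = sim_rep g (even_neg_L2 F)"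
proof -
  obtain f where f: "f \<in> L2_fun" "F = abs_L2 f" by (metis L2_cases)
  obtain r \<theta> b where g': "g = (r, spin \<theta>, b)" "r > 0" by (rule spin_sim_cases[OF g])
  have "even_neg (sim_fun g f y) = sim_fun g (\<lambda>y. even_neg (f y)) y" for y
    by (simp add: g' sim_fun_eq even_neg_scaleC even_neg_scaleR even_neg_spin)
  thus ?thesis
    using f g by (simp add: sim_rep_abs even_neg_L2_abs sim_fun_L2_fun even_neg_L2_fun)
qed

theorem theorem4p6:
  shows "irreducible_unitary_rep spin_sim H_minus sim_rep
    \<and> irreducible_unitary_rep spin_sim H_plus sim_rep
    \<and> equivalent_unitary_reps spin_sim H_minus sim_rep H_plus sim_rep"
proof -
  have "equivalent_unitary_reps spin_sim (H_twist 1) sim_rep (H_twist (- 1)) sim_rep"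
    unfolding equivalent_unitary_reps_def
    using unitary_map_even_neg_L2[of 1] even_neg_L2_sim_rep by blast
  thus ?thesis
    unfolding H_minus_eq H_plus_eq by (simp add: irreducible_H_twist)
qed

end
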